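(* For every undirected weighted $n$-vertex graph $G=(V,E)$ with nonnegative edge weights and every integer $k\geq1$, there is an interactive $O(k)$-emulator of $G$ with size $O(n^{1+\frac{1}{k}})$ and query time $O(1)$.
   Context: An $\alpha$-emulator of $G$ is a weighted graph $H=(V,E',w')$ on the same vertex set ($E'$ need not be a subset of $E$) with $d_G(u,v)\leq d_H(u,v)\leq\alpha\, d_G(u,v)$ for all $u,v\in V$. An interactive $\alpha$-emulator is a pair $(H,D)$ where $H$ is an $\alpha$-emulator and $D$ is an oracle that answers every query $(u,v)\in V^2$ with a $u$–$v$ path $P\subseteq E'$ satisfying $d_G(u,v)\leq w'(P)\leq\alpha\, d_G(u,v)$. Its size is $\max\{|E'|,|D|\}$, with $|D|$ the storage of $D$ in words; query time $q$ means each query is answered in time $O(q+|P|)$. *)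

theory Defs
  imports Complex_Main "HOL-Library.Extended_Real" "HOL-Library.Log_Nat"
begin

section \<open>Undirected weighted graphs\<close>

text \<open>An edge is its two-element set of endpoints.\<close>

record 'a wgraph =
  verts  :: "'a set"
  edges  :: "'a set set"
  weight :: "'a set \<Rightarrow> real"

definition weighted_graph :: "'a wgraph \<Rightarrow> bool" where
  "weighted_graph G \<longleftrightarrow>
     finite (verts G) \<and>
     edges G \<subseteq> {{x, y} | x y. x \<in> verts G \<and> y \<in> verts G \<and> x \<noteq> y} \<and>
     (\<forall>e\<in>edges G. 0 \<le> weight G e)"

definition is_path :: "'a wgraph \<Rightarrow> 'a \<Rightarrow> 'a list \<Rightarrow> 'a \<Rightarrow> bool" where
  "is_path G u p v \<longleftrightarrow>
     p \<noteq> [] \<and> hd p = u \<and> last p = v \<and> set p \<subseteq> verts G \<and> distinct p \<and>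
     successively (\<lambda>x y. {x, y} \<in> edges G) p"

definition path_length :: "'a list \<Rightarrow> nat" where
  "path_length p = length p - 1"

definition path_weight :: "'a wgraph \<Rightarrow> 'a list \<Rightarrow> real" where
  "path_weight G p = (\<Sum>i<path_length p. weight G {p ! i, p ! Suc i})"

text \<open>The distance is \<open>\<infinity>\<close> between different connected components.\<close>

definition gdist :: "'a wgraph \<Rightarrow> 'a \<Rightarrow> 'a \<Rightarrow> ereal" where
  "gdist G u v = (INF p\<in>{p. is_path G u p v}. ereal (path_weight G p))"

definition emulator :: "real \<Rightarrow> 'a wgraph \<Rightarrow> 'a wgraph \<Rightarrow> bool" where
  "emulator \<alpha> G H \<longleftrightarrow>
     weighted_graph H \<and> verts H = verts G \<and>
     (\<forall>u\<in>verts G. \<forall>v\<in>verts G.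
        gdist G u v \<le> gdist H u v \<and> gdist H u v \<le> ereal \<alpha> * gdist G u v)"

section \<open>The word RAM\<close>

text \<open>
  A query is answered by a word RAM with \<open>w\<close>-bit words and unit-cost instructions. It has
  registers that can only be addressed directly, a read-only memory holding the stored data
  structure, a read-write scratch memory that is zero at the start of each query, and a
  write-only output sequence. All arithmetic is modulo \<open>2 ^ w\<close>. Words are bounded
  integers rather than reals, so that a cell holds exactly \<open>w\<close> bits.
\<close>

type_synonym reg = nat

datatype binop = Plus | Minus | Times | Div | Mod | And | Or | Xor | Shl | Shr | Less | Eq

datatype instr =
    Const reg nat
  | Bin binop reg reg reg   \<comment> \<open>operator, target, left operand, right operand\<close>
  | Read reg reg            \<comment> \<open>target, register holding an address in the data structure\<close>
  | Load reg reg            \<comment> \<open>target, register holding a scratch address\<close>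
  | Store reg reg           \<comment> \<open>register holding a scratch address, source\<close>
  | Emit reg
  | Jump_Zero reg nat       \<comment> \<open>tested register, absolute target\<close>

record config =
  pc      :: nat
  regs    :: "reg \<Rightarrow> nat"
  scratch :: "nat \<Rightarrow> nat"
  outp    :: "nat list"

fun binop_val :: "nat \<Rightarrow> binop \<Rightarrow> nat \<Rightarrow> nat \<Rightarrow> nat" where
  "binop_val w Plus x y = (x + y) mod 2 ^ w"
| "binop_val w Minus x y = (x + 2 ^ w - y) mod 2 ^ w"
| "binop_val w Times x y = (x * y) mod 2 ^ w"
| "binop_val w Div x y = x div y"
| "binop_val w Mod x y = x mod y"
| "binop_val w And x y = and x y"
| "binop_val w Or x y = or x y"
| "binop_val w Xor x y = xor x y"
| "binop_val w Shl x y = push_bit y x mod 2 ^ w"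
| "binop_val w Shr x y = drop_bit y x"
| "binop_val w Less x y = of_bool (x < y) mod 2 ^ w"
| "binop_val w Eq x y = of_bool (x = y) mod 2 ^ w"

fun exec :: "nat \<Rightarrow> nat list \<Rightarrow> instr \<Rightarrow> config \<Rightarrow> config" where
  "exec w D (Const r a) c =
     c\<lparr>pc := Suc (pc c), regs := (regs c)(r := a mod 2 ^ w)\<rparr>"
| "exec w D (Bin b r s t) c =
     c\<lparr>pc := Suc (pc c), regs := (regs c)(r := binop_val w b (regs c s) (regs c t))\<rparr>"
| "exec w D (Read r s) c =
     c\<lparr>pc := Suc (pc c),
       regs := (regs c)(r := (if regs c s < length D then D ! regs c s else 0))\<rparr>"
| "exec w D (Load r s) c =
     c\<lparr>pc := Suc (pc c), regs := (regs c)(r := scratch c (regs c s))\<rparr>"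
| "exec w D (Store s r) c =
     c\<lparr>pc := Suc (pc c), scratch := (scratch c)(regs c s := regs c r)\<rparr>"
| "exec w D (Emit r) c =
     c\<lparr>pc := Suc (pc c), outp := outp c @ [regs c r]\<rparr>"
| "exec w D (Jump_Zero r l) c =
     c\<lparr>pc := (if regs c r = 0 then l else Suc (pc c))\<rparr>"

text \<open>The machine halts by leaving the program; a halted configuration steps to itself.\<close>

definition halted :: "instr list \<Rightarrow> config \<Rightarrow> bool" where
  "halted prog c \<longleftrightarrow> length prog \<le> pc c"

definition step :: "nat \<Rightarrow> instr list \<Rightarrow> nat list \<Rightarrow> config \<Rightarrow> config" where
  "step w prog D c = (if halted prog c then c else exec w D (prog ! pc c) c)"

definition init :: "nat \<Rightarrow> nat \<Rightarrow> config" where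
  "init u v = \<lparr>pc = 0, regs = (\<lambda>_. 0)(0 := u, 1 := v), scratch = (\<lambda>_. 0), outp = []\<rparr>"

definition answers_within ::
  "nat \<Rightarrow> instr list \<Rightarrow> nat list \<Rightarrow> nat \<Rightarrow> nat \<Rightarrow> nat \<Rightarrow> nat list \<Rightarrow> bool" where
  "answers_within w prog D u v t p \<longleftrightarrow>
     (let c = (step w prog D ^^ t) (init u v) in halted prog c \<and> outp c = p)"

section \<open>Interactive emulators\<close>

text \<open>
  The oracle consists of a query program \<open>prog\<close> and a stored sequence \<open>D\<close> of \<open>w\<close>-bit words.
  A path is reported as its sequence of vertices; the empty sequence reports that no path
  exists.
\<close>

definition correct_answer ::
  "real \<Rightarrow> 'a wgraph \<Rightarrow> 'a wgraph \<Rightarrow> 'a \<Rightarrow> 'a \<Rightarrow> 'a list \<Rightarrow> bool" where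
  "correct_answer \<alpha> G H u v p \<longleftrightarrow>
     (if gdist G u v = \<infinity> then p = []
      else is_path H u p v \<and>
           gdist G u v \<le> ereal (path_weight H p) \<and>
           ereal (path_weight H p) \<le> ereal \<alpha> * gdist G u v)"

definition interactive_emulator ::
  "nat \<Rightarrow> instr list \<Rightarrow> real \<Rightarrow> nat wgraph \<Rightarrow> nat wgraph \<Rightarrow> nat list \<Rightarrow> bool" where
  "interactive_emulator w prog \<alpha> G H D \<longleftrightarrow>
     emulator \<alpha> G H \<and>
     (\<forall>a\<in>set D. a < 2 ^ w) \<and>
     (\<forall>u\<in>verts G. \<forall>v\<in>verts G.
        \<exists>t p. answers_within w prog D u v t p \<and> correct_answer \<alpha> G H u v p)"

definition emulator_size :: "'a wgraph \<Rightarrow> nat list \<Rightarrow> nat" where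
  "emulator_size H D = max (card (edges H)) (length D)"

text \<open>
  \<open>B\<close> is the constant hidden in the bound \<open>O(q + |P|)\<close>.
\<close>

definition query_time ::
  "nat \<Rightarrow> instr list \<Rightarrow> nat wgraph \<Rightarrow> nat list \<Rightarrow> real \<Rightarrow> real \<Rightarrow> bool" where
  "query_time w prog G D B q \<longleftrightarrow>
     (\<forall>u\<in>verts G. \<forall>v\<in>verts G.
        \<exists>t p. answers_within w prog D u v t p \<and> real t \<le> B * (q + real (path_length p)))"

end

theory Submission
  imports Defs
begin

text \<open>
  A Ramsey-type lemma for finite metric spaces: every \<open>m\<close>-point space has a tree on its points and
  a set \<open>Y\<close> of at least \<open>m\<^sup>1\<^sup>-\<^sup>1\<^sup>/\<^sup>k\<close> points such that tree distances between \<open>Y\<close> and the whole space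
  have distortion at most \<open>64 * k\<close>. It is proved by region growing: a ball is separated from the
  rest, the points in a shell of width proportional to \<open>diameter / k\<close> are given up, and the two
  sides are treated recursively. Applying the lemma to the space, then to the complement of \<open>Y\<close>,
  and so on gives every vertex \<open>v\<close> a home tree with index \<open>home v\<close>. Each space has at most
  \<open>|Y| * n\<^sup>1\<^sup>/\<^sup>k\<close> points and the sets \<open>Y\<close> partition the vertices, so the trees have total size at
  most \<open>n\<^sup>1\<^sup>+\<^sup>1\<^sup>/\<^sup>k\<close>. The emulator is the union of the trees, and a query for \<open>u\<close> and \<open>v\<close> walks from
  both ends towards the lowest common ancestor in the tree with the smaller home index. As this
  takes time linear in the number of reported edges, parent pointers suffice as data structure.
\<close>

section \<open>Ramsey trees in finite pseudometric spaces\<close>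

text \<open>Edges of weight 0 put distinct vertices at distance 0, hence no metric.\<close>

locale pseudometric =
  fixes d :: "'a \<Rightarrow> 'a \<Rightarrow> real"
  assumes dist_self [simp]: "d x x = 0"
    and dist_sym: "d x y = d y x"
    and dist_triangle: "d x z \<le> d x y + d y z"
begin

lemma dist_nonneg [simp]: "0 \<le> d x y"
  using dist_triangle[of x x y] dist_sym[of x y] by simp

section \<open>Walks towards the root and common ancestors\<close>

inductive ascent :: "('a \<Rightarrow> 'a option) \<Rightarrow> 'a \<Rightarrow> 'a \<Rightarrow> real \<Rightarrow> bool" for par where
  refl: "ascent par x x 0"
| step: "par x = Some y \<Longrightarrow> ascent par y z c \<Longrightarrow> ascent par x z (d x y + c)"

lemma ascent_nonneg: "ascent par x y c \<Longrightarrow> 0 \<le> c"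
  by (induction rule: ascent.induct) auto

lemma ascent_mono: "ascent par x y c \<Longrightarrow> par \<subseteq>\<^sub>m par' \<Longrightarrow> ascent par' x y c"
proof (induction rule: ascent.induct)
  case (step x y z c)
  then show ?case
    by (metis ascent.step domI map_le_def)
qed (rule ascent.refl)

lemma ascent_snoc: "ascent par x y c \<Longrightarrow> par y = Some z \<Longrightarrow> ascent par x z (c + d y z)"
proof (induction rule: ascent.induct)
  case (refl x)
  then show ?case using ascent.step[of par x z z 0] ascent.refl by simp
next
  case (step x y z' c)
  then show ?case using ascent.step[of par x y z "c + d z' z"] by (simp add: add.assoc)
qed

text \<open>The common ancestor need not be the lowest one: an upper bound on the cost suffices, and
  it survives every extension of \<open>par\<close>.\<close>

definition linked :: "('a \<Rightarrow> 'a option) \<Rightarrow> 'a \<Rightarrow> 'a \<Rightarrow> real \<Rightarrow> bool" where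
  "linked par u v c \<longleftrightarrow> (\<exists>x a b. ascent par u x a \<and> ascent par v x b \<and> a + b \<le> c)"

lemma linked_mono: "linked par u v c \<Longrightarrow> par \<subseteq>\<^sub>m par' \<Longrightarrow> linked par' u v c"
  unfolding linked_def using ascent_mono by metis

lemma linked_sym: "linked par u v c \<Longrightarrow> linked par v u c"
  unfolding linked_def by (metis add.commute)

text \<open>Ranks exclude cycles, and of two vertices the one of larger rank cannot be an ancestor
  of the other. Being below \<open>card X\<close>, ranks fit into machine words.\<close>

definition ranked_tree :: "'a set \<Rightarrow> 'a \<Rightarrow> ('a \<Rightarrow> 'a option) \<Rightarrow> ('a \<Rightarrow> nat) \<Rightarrow> bool" where
  "ranked_tree X r par rk \<longleftrightarrow>
     r \<in> X \<and> dom par = X - {r} \<and> ran par \<subseteq> X \<and> inj_on rk X \<and> (\<forall>x\<in>X. rk x < card X) \<and>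
     (\<forall>x y. par x = Some y \<longrightarrow> rk y < rk x)"

section \<open>Diameters of finite sets\<close>

definition diam :: "'a set \<Rightarrow> real" where
  "diam X = Max ((\<lambda>(x, y). d x y) ` (X \<times> X))"

lemma dist_le_diam: "finite X \<Longrightarrow> x \<in> X \<Longrightarrow> y \<in> X \<Longrightarrow> d x y \<le> diam X"
  unfolding diam_def by (rule Max_ge) force+

lemma diam_leI:
  assumes "finite X" "X \<noteq> {}" "\<And>x y. x \<in> X \<Longrightarrow> y \<in> X \<Longrightarrow> d x y \<le> c"
  shows "diam X \<le> c"
  unfolding diam_def using assms by (subst Max_le_iff) auto

lemma diam_nonneg: "finite X \<Longrightarrow> X \<noteq> {} \<Longrightarrow> 0 \<le> diam X"
  using dist_le_diam dist_self by (metis ex_in_conv)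

lemma diam_mono: "finite X \<Longrightarrow> Z \<subseteq> X \<Longrightarrow> Z \<noteq> {} \<Longrightarrow> diam Z \<le> diam X"
  by (rule diam_leI) (auto intro: finite_subset dist_le_diam)

text \<open>A star suffices; its centre is the point numbered 0, so that every other point outranks
  it.\<close>

lemma ranked_tree_star:
  assumes "finite X" "X \<noteq> {}"
  obtains r par rk where "ranked_tree X r par rk"
    "\<And>x. x \<in> X \<Longrightarrow> \<exists>c \<le> diam X. ascent par x r c"
proof -
  obtain f where f: "bij_betw f X {0..<card X}"
    using ex_bij_betw_finite_nat[OF assms(1)] by blast
  have "0 \<in> f ` X" using f assms by (auto simp: bij_betw_def card_gt_0_iff)
  then obtain r where r: "r \<in> X" "f r = 0" by auto
  define par where "par = (\<lambda>x. if x \<in> X - {r} then Some r else None)"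
  have inj: "inj_on f X" and im: "f ` X = {0..<card X}" using f by (auto simp: bij_betw_def)
  have "ranked_tree X r par f"
    unfolding ranked_tree_def
  proof (intro conjI ballI allI impI)
    show "dom par = X - {r}" by (auto simp: par_def split: if_splits)
    show "ran par \<subseteq> X" using r by (auto simp: par_def ran_def split: if_splits)
    show "f x < card X" if "x \<in> X" for x using im that by auto
    show "f y < f x" if "par x = Some y" for x y
    proof -
      have "x \<in> X" "x \<noteq> r" "y = r" using that by (auto simp: par_def split: if_splits)
      then have "f x \<noteq> 0" using inj r by (metis inj_onD)
      then show ?thesis using r \<open>y = r\<close> by simp
    qed
  qed (use r inj in auto)
  moreover have "\<exists>c \<le> diam X. ascent par x r c" if "x \<in> X" for x
  proof (cases "x = r")
    case True
    then show ?thesis using ascent.refl diam_nonneg assms by blast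
  next
    case False
    then have "ascent par x r (d x r + 0)"
      using that by (intro ascent.step ascent.refl) (simp add: par_def)
    then show ?thesis using dist_le_diam[OF assms(1) that r(1)] by auto
  qed
  ultimately show thesis by (rule that)
qed

text \<open>The root of \<open>Q\<close> becomes a child of the other root. Ranks in
  \<open>Q\<close> are shifted by \<open>card (X - Q)\<close>, so that the new edge decreases the
  rank and the two ranges of ranks stay disjoint.\<close>

lemma ranked_tree_join:
  assumes "finite X" "Q \<subseteq> X"
    and T1: "ranked_tree Q r1 par1 rk1" and T2: "ranked_tree (X - Q) r2 par2 rk2"
  obtains par rk where "ranked_tree X r2 par rk" "par1 \<subseteq>\<^sub>m par" "par2 \<subseteq>\<^sub>m par" "par r1 = Some r2"
proof -
  define par where "par = (par2 ++ par1)(r1 \<mapsto> r2)"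
  define rk where "rk = (\<lambda>x. if x \<in> Q then card (X - Q) + rk1 x else rk2 x)"
  have dom1: "dom par1 = Q - {r1}" and dom2: "dom par2 = X - Q - {r2}"
    and r: "r1 \<in> Q" "r2 \<in> X - Q"
    using T1 T2 by (auto simp: ranked_tree_def)
  have less2: "rk2 x < card (X - Q)" if "x \<in> X - Q" for x
    using T2 that by (auto simp: ranked_tree_def)
  have less1: "rk1 x < card Q" if "x \<in> Q" for x
    using T1 that by (auto simp: ranked_tree_def)
  have card: "card X = card (X - Q) + card Q"
    using assms(1,2) by (metis card_Diff_subset card_mono finite_subset le_add_diff_inverse2)
  have p1: "par1 \<subseteq>\<^sub>m par"
    unfolding map_le_def
  proof
    fix a assume a: "a \<in> dom par1"
    then have "a \<noteq> r1" using dom1 by auto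
    then show "par1 a = par a" using a by (simp add: par_def map_add_dom_app_simps)
  qed
  have p2: "par2 \<subseteq>\<^sub>m par"
    unfolding map_le_def
  proof
    fix a assume a: "a \<in> dom par2"
    then have "a \<noteq> r1" "a \<notin> dom par1" using dom1 dom2 r by auto
    then show "par2 a = par a"
      by (simp add: par_def map_add_dom_app_simps)
  qed
  have cases: "x \<in> Q \<and> y \<in> Q \<and> par1 x = Some y \<or> x \<in> X - Q \<and> y \<in> X - Q \<and> par2 x = Some y
      \<or> x = r1 \<and> y = r2" if "par x = Some y" for x y
  proof (cases "x = r1")
    case True
    then show ?thesis using that by (auto simp: par_def)
  next
    case False
    then have "par1 x = Some y \<or> par2 x = Some y"
      using that by (auto simp: par_def map_add_Some_iff)
    moreover have "par1 x = Some y \<Longrightarrow> x \<in> Q \<and> y \<in> Q"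
      using T1 dom1 by (auto simp: ranked_tree_def dest: ranI)
    moreover have "par2 x = Some y \<Longrightarrow> x \<in> X - Q \<and> y \<in> X - Q"
      using T2 dom2 by (auto simp: ranked_tree_def dest: ranI)
    ultimately show ?thesis by blast
  qed
  have "ranked_tree X r2 par rk"
    unfolding ranked_tree_def
  proof (intro conjI ballI allI impI)
    show "dom par = X - {r2}" using dom1 dom2 r assms(2) by (auto simp: par_def)
    show "ran par \<subseteq> X"
    proof
      fix y assume "y \<in> ran par"
      then obtain x where "par x = Some y" by (auto simp: ran_def)
      from cases[OF this] show "y \<in> X" using r assms(2) by auto
    qed
    show "inj_on rk X"
    proof (rule inj_onI)
      fix x y assume xy: "x \<in> X" "y \<in> X" "rk x = rk y"
      have "inj_on rk1 Q" "inj_on rk2 (X - Q)" using T1 T2 by (auto simp: ranked_tree_def)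
      then show "x = y"
        using xy less2[of x] less2[of y] by (auto simp: rk_def split: if_splits dest: inj_onD)
    qed
    show "rk x < card X" if "x \<in> X" for x
      using that less1[of x] less2[of x] card by (auto simp: rk_def)
    show "rk y < rk x" if "par x = Some y" for x y
      using cases[OF that]
    proof (elim disjE)
      assume "x = r1 \<and> y = r2"
      then show ?thesis using r less2[OF r(2)] by (simp add: rk_def)
    qed (use T1 T2 in \<open>auto simp: rk_def ranked_tree_def\<close>)
  qed (use r in auto)
  moreover have "par r1 = Some r2" by (simp add: par_def)
  ultimately show thesis using p1 p2 that by blast
qed

text \<open>If every step grew by a factor above \<open>(m / a 0) powr (1 / k)\<close>, the
  \<open>k\<close> steps together would give \<open>a k > m\<close>.\<close>

lemma exists_slow_growth:
  fixes a :: "nat \<Rightarrow> real"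
  assumes "1 \<le> k" "0 < a 0" "a k \<le> m"
  shows "\<exists>i<k. a (Suc i) * a 0 powr (1 / real k) \<le> a i * m powr (1 / real k)"
proof (rule ccontr)
  assume neg: "\<not> ?thesis"
  define p where "p = 1 / real k"
  have step: "a i * m powr p < a (Suc i) * a 0 powr p" if "i < k" for i
    using neg that by (auto simp: p_def not_le)
  have pos: "0 < a 0 powr p" using assms by simp
  have grow: "i \<le> k \<Longrightarrow> a 0 * (m powr p) ^ i \<le> a i * (a 0 powr p) ^ i
      \<and> (0 < i \<longrightarrow> a 0 * (m powr p) ^ i < a i * (a 0 powr p) ^ i)" for i
  proof (induction i)
    case (Suc i)
    then have IH: "a 0 * (m powr p) ^ i \<le> a i * (a 0 powr p) ^ i" by simp
    have "a 0 * (m powr p) ^ Suc i = (a 0 * (m powr p) ^ i) * m powr p" by simp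
    also have "\<dots> \<le> (a i * (a 0 powr p) ^ i) * m powr p"
      using IH by (rule mult_right_mono) simp
    also have "\<dots> = (a i * m powr p) * (a 0 powr p) ^ i" by simp
    also have "\<dots> < (a (Suc i) * a 0 powr p) * (a 0 powr p) ^ i"
      using step[of i] Suc.prems pos by (intro mult_strict_right_mono) auto
    finally show ?case by simp
  qed simp
  have kp: "real k * p = 1" using assms(1) by (simp add: p_def)
  have "a 0 * (m powr p) ^ k < a k * (a 0 powr p) ^ k" using grow[of k] assms(1) by simp
  moreover have "(a 0 powr p) ^ k = a 0"
    using assms kp by (simp add: powr_realpow[symmetric] powr_powr mult.commute)
  ultimately have *: "a 0 * (m powr p) ^ k < a k * a 0" by simp
  \<comment> \<open>Cancelling the root against the power needs \<open>m > 0\<close>, which follows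
    from \<open>a k \<le> m\<close> once the strict inequality shows \<open>a k > 0\<close>.\<close>
  have "0 \<le> a 0 * (m powr p) ^ k" using assms by simp
  with * assms have "0 < a k" by (metis le_less_trans mult_pos_pos zero_less_mult_pos2)
  then have "0 < m" using assms by simp
  then have "(m powr p) ^ k = m"
    using kp by (simp add: powr_realpow[symmetric] powr_powr mult.commute)
  with * assms show False by (simp add: mult.commute)
qed

section \<open>Ramsey trees by region growing\<close>

text \<open>The 2 in the height bound sums a geometric series, since a cluster hung below another
  root has at most half the diameter. Two ascents then cost at most \<open>4 * diam X\<close>, which
  is \<open>64 * k\<close> times the separation \<open>diam X / (16 * k)\<close>.\<close>

definition ramsey_tree ::
  "nat \<Rightarrow> 'a set \<Rightarrow> 'a set \<Rightarrow> 'a \<Rightarrow> ('a \<Rightarrow> 'a option) \<Rightarrow> ('a \<Rightarrow> nat) \<Rightarrow> bool" where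
  "ramsey_tree k X Y r par rk \<longleftrightarrow>
     ranked_tree X r par rk \<and> (\<forall>x\<in>X. \<exists>c \<le> 2 * diam X. ascent par x r c) \<and>
     (\<forall>u\<in>Y. \<forall>v\<in>X. linked par u v (64 * real k * d u v))"

text \<open>Zero diameter makes all costs in the star zero, and for empty \<open>M\<close> the
  distortion condition is vacuous.\<close>

lemma ramsey_tree_exists_star:
  assumes "finite X" "X \<noteq> {}" "M \<subseteq> X" "1 \<le> k" "diam X = 0 \<or> M = {}"
  shows "\<exists>r par rk. ramsey_tree k X M r par rk"
proof -
  obtain r par rk where T: "ranked_tree X r par rk"
    "\<And>x. x \<in> X \<Longrightarrow> \<exists>c \<le> diam X. ascent par x r c"
    using ranked_tree_star assms by blast
  have "linked par u v (64 * real k * d u v)" if "u \<in> M" "v \<in> X" for u v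
  proof -
    have "diam X = 0" using that assms by auto
    moreover have "u \<in> X" using that assms(3) by blast
    ultimately obtain a where a: "ascent par u r a" "a \<le> 0" using T(2) by metis
    obtain b where b: "ascent par v r b" "b \<le> 0" using T(2)[OF \<open>v \<in> X\<close>] \<open>diam X = 0\<close> by metis
    have "a + b \<le> 64 * real k * d u v" using a b dist_nonneg[of u v]
      by (metis add_nonpos_nonpos mult_nonneg_nonneg of_nat_0_le_iff order_trans zero_le_numeral)
    then show ?thesis using a b unfolding linked_def by blast
  qed
  moreover have "\<exists>c \<le> 2 * diam X. ascent par x r c" if "x \<in> X" for x
  proof -
    obtain c where "ascent par x r c" "c \<le> diam X" using T(2)[OF \<open>x \<in> X\<close>] by blast
    then show ?thesis using diam_nonneg[OF assms(1,2)] by (intro exI[of _ c]) auto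
  qed
  ultimately show ?thesis using T(1) unfolding ramsey_tree_def by blast
qed

text \<open>Pairs on the same side keep their link. Pairs on different sides are far enough apart to
  afford the detour through the root \<open>r2\<close>.\<close>

lemma ramsey_tree_join:
  assumes "finite X" "Q \<subseteq> X" "1 \<le> k" "diam Q \<le> diam X / 2"
    and R1: "ramsey_tree k Q Y1 r1 par1 rk1" and R2: "ramsey_tree k (X - Q) Y2 r2 par2 rk2"
    and far1: "\<And>u v. u \<in> Y1 \<Longrightarrow> v \<in> X - Q \<Longrightarrow> diam X / (16 * real k) \<le> d u v"
    and far2: "\<And>u v. u \<in> Y2 \<Longrightarrow> v \<in> Q \<Longrightarrow> diam X / (16 * real k) \<le> d u v"
    and sub: "Y1 \<subseteq> Q" "Y2 \<subseteq> X - Q"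
  shows "\<exists>par rk. ramsey_tree k X (Y1 \<union> Y2) r2 par rk"
proof -
  have T1: "ranked_tree Q r1 par1 rk1" and T2: "ranked_tree (X - Q) r2 par2 rk2"
    using R1 R2 by (auto simp: ramsey_tree_def)
  obtain par rk where T: "ranked_tree X r2 par rk" "par1 \<subseteq>\<^sub>m par" "par2 \<subseteq>\<^sub>m par" "par r1 = Some r2"
    using ranked_tree_join[OF assms(1,2) T1 T2] by blast
  have r: "r1 \<in> Q" "r2 \<in> X - Q" using T1 T2 by (auto simp: ranked_tree_def)
  have up: "\<exists>c \<le> 2 * diam X. ascent par x r2 c" if x: "x \<in> X" for x
  proof (cases "x \<in> Q")
    case True
    then obtain c where c: "c \<le> 2 * diam Q" "ascent par1 x r1 c"
      using R1 by (auto simp: ramsey_tree_def)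
    \<comment> \<open>The halved diameter pays for the extra edge:
      \<open>2 * diam Q + diam X \<le> 2 * diam X\<close>.\<close>
    have "ascent par x r2 (c + d r1 r2)"
      using ascent_snoc ascent_mono c(2) T by blast
    moreover have "d r1 r2 \<le> diam X" using r assms by (intro dist_le_diam) auto
    ultimately show ?thesis using c(1) assms(4) by (intro exI[of _ "c + d r1 r2"]) auto
  next
    case False
    then have "x \<in> X - Q" using x by simp
    then obtain c where c: "c \<le> 2 * diam (X - Q)" "ascent par2 x r2 c"
      using R2 unfolding ramsey_tree_def by blast
    moreover have "diam (X - Q) \<le> diam X" using r assms(1) by (intro diam_mono) auto
    ultimately show ?thesis using T(3) ascent_mono by (intro exI[of _ c]) auto
  qed
  have cross: "linked par u v (64 * real k * d u v)"
    if "u \<in> X" "v \<in> X" "diam X / (16 * real k) \<le> d u v" for u v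
  proof -
    obtain a b where ab: "ascent par u r2 a" "ascent par v r2 b" "a \<le> 2 * diam X" "b \<le> 2 * diam X"
      using up \<open>u \<in> X\<close> \<open>v \<in> X\<close> by metis
    have "4 * diam X = 64 * real k * (diam X / (16 * real k))"
      using assms(3) by (simp add: field_simps)
    also have "\<dots> \<le> 64 * real k * d u v" using that(3) by (intro mult_left_mono) auto
    finally have "a + b \<le> 64 * real k * d u v" using ab by simp
    then show ?thesis using ab unfolding linked_def by blast
  qed
  have "linked par u v (64 * real k * d u v)" if uv: "u \<in> Y1 \<union> Y2" "v \<in> X" for u v
  proof -
    consider "u \<in> Y1" "v \<in> Q" | "u \<in> Y1" "v \<in> X - Q" | "u \<in> Y2" "v \<in> Q" | "u \<in> Y2" "v \<in> X - Q"
      using uv by blast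
    then show ?thesis
    proof cases
      case 1
      then show ?thesis using R1 linked_mono[OF _ T(2)] unfolding ramsey_tree_def by blast
    next
      case 2
      then show ?thesis using far1 cross sub assms(2) by blast
    next
      case 3
      then show ?thesis using far2 cross sub assms(2) by blast
    next
      case 4
      then show ?thesis using R2 linked_mono[OF _ T(3)] unfolding ramsey_tree_def by blast
    qed
  qed
  then show ?thesis using T(1) up unfolding ramsey_tree_def by blast
qed

text \<open>
  The hypothesis bounds the number of points of \<open>M\<close> in balls whose radius is a fixed fraction
  of the diameter. The center \<open>z\<close> maximises the number of points in the ball of half that
  radius; this maximum bounds the corresponding number for the cluster around \<open>z\<close>, whose
  diameter is at most half of \<open>diam X\<close>. The loss in the shell around the cluster is therefore
  paid for by the drop of the bound \<open>m\<close>.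
\<close>

lemma ramsey_tree_exists:
  assumes "finite X" "X \<noteq> {}" "M \<subseteq> X" "1 \<le> k"
    and "\<And>x. x \<in> X \<Longrightarrow> real (card {y\<in>M. d x y \<le> diam X / 4}) \<le> m"
  shows "\<exists>Y r par rk. ramsey_tree k X Y r par rk \<and> Y \<subseteq> M \<and>
           real (card M) \<le> real (card Y) * m powr (1 / real k)"
  using assms
proof (induction "card X" arbitrary: X M m rule: less_induct)
  case less
  have fin: "finite X" "finite M" using less.prems finite_subset by auto
  define p where "p = 1 / real k"
  show ?case
  proof (cases "diam X = 0 \<or> M = {}")
    case True
    \<comment> \<open>Here \<open>M\<close> itself serves as \<open>Y\<close>. Each point of
      \<open>M\<close> lies in its own ball, so \<open>m \<ge> 1\<close> unless \<open>M\<close> is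
      empty.\<close>
    have "real (card M) \<le> real (card M) * m powr p"
    proof (cases "M = {}")
      case False
      then obtain x where x: "x \<in> M" by auto
      then have "x \<in> {y\<in>M. d x y \<le> diam X / 4}"
        using diam_nonneg[OF less.prems(1,2)] by simp
      then have "{y\<in>M. d x y \<le> diam X / 4} \<noteq> {}" by blast
      moreover have "finite {y\<in>M. d x y \<le> diam X / 4}" using fin(2) by simp
      ultimately have "1 \<le> card {y\<in>M. d x y \<le> diam X / 4}"
        by (metis One_nat_def Suc_leI card_gt_0_iff)
      then have "1 \<le> m" using less.prems(5)[of x] x less.prems(3) by fastforce
      then have "1 \<le> m powr p" by (simp add: p_def ge_one_powr_ge_zero)
      then show ?thesis by (simp add: mult_le_cancel_left1)
    qed simp
    then show ?thesis
      using ramsey_tree_exists_star[OF less.prems(1-4) True] unfolding p_def by blast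
  next
    case False
    define \<Delta> where "\<Delta> = diam X"
    have \<Delta>: "0 < \<Delta>" using False diam_nonneg[OF less.prems(1,2)] by (auto simp: \<Delta>_def)
    define f where "f x = card {y\<in>M. d x y \<le> \<Delta> / 8}" for x
    have "Max (f ` X) \<in> f ` X" using less.prems(1,2) by (intro Max_in) auto
    then obtain z where "z \<in> X" "f z = Max (f ` X)" by auto
    then have z: "z \<in> X" "\<And>x. x \<in> X \<Longrightarrow> f x \<le> f z" using less.prems(1) by auto
    \<comment> \<open>The radii run from \<open>\<Delta> / 8\<close> to \<open>\<Delta> / 4\<close>
      in \<open>k\<close> equal steps, so the last ball is one that \<open>m\<close> bounds.\<close>
    define \<rho> where "\<rho> i = \<Delta> / 8 + real i * (\<Delta> / (8 * real k))" for i
    define a where "a i = real (card {y\<in>M. d z y \<le> \<rho> i})" for i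
    have a0: "a 0 = real (f z)" by (simp add: a_def f_def \<rho>_def)
    obtain x where x: "x \<in> M" using False by auto
    have "x \<in> {y\<in>M. d x y \<le> \<Delta> / 8}" using x \<Delta> by simp
    then have "0 < f x" unfolding f_def using fin by (auto simp: card_gt_0_iff)
    then have a0_pos: "0 < a 0" using z(2)[of x] x less.prems(3) a0 by fastforce
    have "\<rho> k = diam X / 4" using less.prems(4) by (simp add: \<rho>_def \<Delta>_def field_simps)
    then have "a k \<le> m" using less.prems(5)[OF z(1)] unfolding a_def by metis
    then obtain i where i: "i < k" "a (Suc i) * a 0 powr p \<le> a i * m powr p"
      using exists_slow_growth[of k a m] a0_pos less.prems(4) by (auto simp: p_def)
    \<comment> \<open>The cut is in the middle of the shell: \<open>M1\<close> and \<open>M2\<close>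
      both keep half its width, \<open>\<Delta> / (16 * k)\<close>, as distance from the other
      side.\<close>
    define s where "s = \<rho> i + \<Delta> / (16 * real k)"
    define Q where "Q = {x\<in>X. d z x \<le> s}"
    define M1 where "M1 = {y\<in>M. d z y \<le> \<rho> i}"
    define M2 where "M2 = {y\<in>M. \<rho> (Suc i) < d z y}"
    have \<rho>_Suc: "\<rho> (Suc i) = s + \<Delta> / (16 * real k)"
      by (simp add: \<rho>_def s_def add_divide_distrib algebra_simps)
    have k\<Delta>: "0 < \<Delta> / (16 * real k)" using \<Delta> less.prems(4) by simp
    have "s \<le> \<rho> (Suc i)" using \<rho>_Suc k\<Delta> by simp
    also have "\<dots> \<le> \<rho> k"
      unfolding \<rho>_def using i(1) \<Delta> by (intro add_left_mono mult_right_mono) auto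
    finally have s_le: "s \<le> \<Delta> / 4" using \<open>\<rho> k = diam X / 4\<close> by (simp add: \<Delta>_def)
    have "0 \<le> s" unfolding s_def \<rho>_def using \<Delta> by simp
    then have zQ: "z \<in> Q" using z(1) by (simp add: Q_def)
    have QX: "Q \<subseteq> X" "finite Q" using fin(1) by (auto simp: Q_def)
    have diamQ: "diam Q \<le> \<Delta> / 2"
    proof (rule diam_leI[OF QX(2)])
      fix x y assume "x \<in> Q" "y \<in> Q"
      then have "d z x \<le> \<Delta> / 4" "d z y \<le> \<Delta> / 4" using s_le by (auto simp: Q_def)
      then show "d x y \<le> \<Delta> / 2" using dist_triangle[of x y z] dist_sym[of x z] by simp
    qed (use zQ in auto)
    have "Q \<noteq> X" using diamQ \<Delta> by (auto simp: \<Delta>_def)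
    then have proper: "X - Q \<noteq> {}" "card Q < card X" using QX fin(1) by (auto intro: psubset_card_mono)
    have "card (X - Q) < card X" using fin(1) zQ z(1) by (intro psubset_card_mono) auto
    have M1: "M1 \<subseteq> Q" using less.prems(3) k\<Delta> by (auto simp: M1_def Q_def s_def)
    have M2: "M2 \<subseteq> X - Q" using less.prems(3) k\<Delta> \<rho>_Suc by (auto simp: M2_def Q_def)
    \<comment> \<open>Since \<open>diam Q / 4 \<le> \<Delta> / 8\<close>, the choice of
      \<open>z\<close> bounds these balls by \<open>a 0\<close>: inside the cluster,
      \<open>a 0\<close> replaces \<open>m\<close>.\<close>
    have "real (card {y\<in>M1. d x y \<le> diam Q / 4}) \<le> a 0" if "x \<in> Q" for x
    proof -
      have "card {y\<in>M1. d x y \<le> diam Q / 4} \<le> f x"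
        unfolding f_def using fin(2) diamQ by (intro card_mono) (auto simp: M1_def)
      also have "\<dots> \<le> f z" using z(2) that QX by auto
      finally show ?thesis using a0 by simp
    qed
    from less.hyps[OF proper(2) QX(2) _ M1 less.prems(4) this] zQ
    obtain Y1 r1 par1 rk1 where R1: "ramsey_tree k Q Y1 r1 par1 rk1" "Y1 \<subseteq> M1"
      "real (card M1) \<le> real (card Y1) * a 0 powr p" unfolding p_def by blast
    \<comment> \<open>The diameter does not grow on this side, so the bound \<open>m\<close> is
      inherited.\<close>
    have "real (card {y\<in>M2. d x y \<le> diam (X - Q) / 4}) \<le> m" if "x \<in> X - Q" for x
    proof -
      have "diam (X - Q) \<le> diam X" using proper(1) fin(1) by (intro diam_mono) auto
      then have "card {y\<in>M2. d x y \<le> diam (X - Q) / 4} \<le> card {y\<in>M. d x y \<le> diam X / 4}"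
        using fin(2) by (intro card_mono) (auto simp: M2_def)
      then show ?thesis using less.prems(5)[of x] that by simp
    qed
    from less.hyps[OF \<open>card (X - Q) < card X\<close> _ proper(1) M2 less.prems(4) this] fin(1)
    obtain Y2 r2 par2 rk2 where R2: "ramsey_tree k (X - Q) Y2 r2 par2 rk2" "Y2 \<subseteq> M2"
      "real (card M2) \<le> real (card Y2) * m powr p" unfolding p_def by blast
    have far1: "diam X / (16 * real k) \<le> d u v" if "u \<in> Y1" "v \<in> X - Q" for u v
    proof -
      have "d z u \<le> \<rho> i" "s < d z v" using that R1(2) by (auto simp: M1_def Q_def)
      then show ?thesis using dist_triangle[of z v u] by (simp add: s_def \<Delta>_def)
    qed
    have far2: "diam X / (16 * real k) \<le> d u v" if "u \<in> Y2" "v \<in> Q" for u v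
    proof -
      have "\<rho> (Suc i) < d z u" "d z v \<le> s" using that R2(2) by (auto simp: M2_def Q_def)
      then show ?thesis using dist_triangle[of z u v] dist_sym[of u v] \<rho>_Suc by (simp add: \<Delta>_def)
    qed
    obtain par rk where R: "ramsey_tree k X (Y1 \<union> Y2) r2 par rk"
      using ramsey_tree_join[OF fin(1) QX(1) less.prems(4) _ R1(1) R2(1) far1 far2]
        diamQ R1(2) R2(2) M1 M2 unfolding \<Delta>_def by (meson order_trans)
    \<comment> \<open>\<open>Y1\<close> pays for all points up to radius
      \<open>\<rho> (Suc i)\<close>, the shell included: the factor \<open>a 0 powr p\<close> from
      the recursive bound for \<open>M1\<close> cancels against the one from slow growth.\<close>
    have "a (Suc i) * a 0 powr p \<le> (real (card Y1) * m powr p) * a 0 powr p"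
    proof -
      have "a i * m powr p \<le> (real (card Y1) * a 0 powr p) * m powr p"
        using R1(3) by (intro mult_right_mono) (auto simp: a_def M1_def)
      then show ?thesis using i(2) by (simp add: mult_ac)
    qed
    then have shell: "a (Suc i) \<le> real (card Y1) * m powr p" using a0_pos by simp
    have "card M = card {y\<in>M. d z y \<le> \<rho> (Suc i)} + card M2"
      using fin(2) unfolding M2_def
      by (subst card_Un_disjoint[symmetric]) (auto intro: arg_cong[where f = card])
    then have "real (card M) \<le> real (card Y1) * m powr p + real (card Y2) * m powr p"
      using shell R2(3) by (simp add: a_def)
    moreover have "card (Y1 \<union> Y2) = card Y1 + card Y2"
    proof (rule card_Un_disjoint)
      show "finite Y1" using R1(2) M1 QX(2) finite_subset by metis
      show "finite Y2" using R2(2) M2 fin(1) finite_subset finite_Diff by metis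
      show "Y1 \<inter> Y2 = {}" using R1(2) R2(2) M1 M2 by blast
    qed
    ultimately have "real (card M) \<le> real (card (Y1 \<union> Y2)) * m powr p"
      by (simp add: distrib_right)
    moreover have "Y1 \<union> Y2 \<subseteq> M" using R1(2) R2(2) by (auto simp: M1_def M2_def)
    ultimately show ?thesis using R unfolding p_def by blast
  qed
qed

section \<open>Hierarchies of Ramsey trees\<close>

text \<open>Tree \<open>j\<close> lives on the points with \<open>j \<le> home x\<close>, and
  \<open>home x\<close> is the stage at which \<open>x\<close> enters the set \<open>Y\<close>. The
  smaller home index thus names a tree that contains both points and has good distortion for one of
  them.\<close>

definition ramsey_hierarchy ::
  "nat \<Rightarrow> 'a set \<Rightarrow> ('a \<Rightarrow> nat) \<Rightarrow> (nat \<Rightarrow> 'a \<Rightarrow> 'a option) \<Rightarrow> (nat \<Rightarrow> 'a \<Rightarrow> nat) \<Rightarrow> bool" where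
  "ramsey_hierarchy k X home par rk \<longleftrightarrow>
     (\<forall>j x y. par j x = Some y \<longrightarrow> x \<in> X \<and> y \<in> X \<and> j \<le> home x \<and> j \<le> home y \<and> rk j y < rk j x) \<and>
     (\<forall>j. inj_on (rk j) {x\<in>X. j \<le> home x}) \<and>
     (\<forall>j. \<forall>x\<in>X. j \<le> home x \<longrightarrow> rk j x < card X) \<and>
     (\<forall>u\<in>X. \<forall>v\<in>X. linked (par (min (home u) (home v))) u v (64 * real k * d u v))"

text \<open>The tree found for \<open>X\<close> becomes tree 0 and the hierarchy of
  \<open>X - Y\<close> is shifted by one. \<open>Suc (home x)\<close> counts the trees containing
  \<open>x\<close>. As \<open>N\<close> stays fixed while \<open>X\<close> shrinks, the charges
  \<open>|Y| * N powr (1 / k)\<close> of all stages add up.\<close>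

lemma ramsey_hierarchy_exists:
  assumes "finite X" "1 \<le> k" "real (card X) \<le> N"
  shows "\<exists>home par rk. ramsey_hierarchy k X home par rk \<and>
           real (\<Sum>x\<in>X. Suc (home x)) \<le> real (card X) * N powr (1 / real k)"
  using assms
proof (induction "card X" arbitrary: X rule: less_induct)
  case less
  define p where "p = 1 / real k"
  show ?case
  proof (cases "X = {}")
    case True
    then have "ramsey_hierarchy k X (\<lambda>_. 0) (\<lambda>_ _. None) (\<lambda>_ _. 0)"
      by (simp add: ramsey_hierarchy_def)
    then show ?thesis using True by (auto intro!: exI)
  next
    case False
    have "real (card {y\<in>X. d x y \<le> diam X / 4}) \<le> real (card X)" for x
      using less.prems(1) by (simp add: card_mono)
    from ramsey_tree_exists[OF less.prems(1) False subset_refl less.prems(2) this]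
    obtain Y r par rk where R: "ramsey_tree k X Y r par rk" "Y \<subseteq> X"
      "real (card X) \<le> real (card Y) * real (card X) powr p" unfolding p_def by blast
    have finY: "finite Y" using R(2) less.prems(1) finite_subset by blast
    have cardX: "0 < card X" using False less.prems(1) by (simp add: card_gt_0_iff)
    have "Y \<noteq> {}" using R(3) cardX by auto
    then have smaller: "card (X - Y) < card X"
      using less.prems(1) R(2) by (intro psubset_card_mono) auto
    have "real (card (X - Y)) \<le> N" using smaller less.prems(3) by simp
    from less.hyps[OF smaller _ less.prems(2) this] less.prems(1)
    obtain home' par' rk' where H: "ramsey_hierarchy k (X - Y) home' par' rk'"
      and sum': "real (\<Sum>x\<in>X - Y. Suc (home' x)) \<le> real (card (X - Y)) * N powr p"
      unfolding p_def by blast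
    define home where "home x = (if x \<in> Y then 0 else Suc (home' x))" for x
    define Par where "Par = case_nat par par'"
    define Rk where "Rk = case_nat rk rk'"
    have T: "ranked_tree X r par rk" using R(1) by (simp add: ramsey_tree_def)
    have "ramsey_hierarchy k X home Par Rk"
      unfolding ramsey_hierarchy_def
    proof (intro conjI allI impI ballI)
      fix j x y assume "Par j x = Some y"
      then have "x \<in> X \<and> y \<in> X \<and> j \<le> home x \<and> j \<le> home y \<and> Rk j y < Rk j x"
      proof (cases j)
        case 0
        then have "par x = Some y" using \<open>Par j x = Some y\<close> by (simp add: Par_def)
        moreover from this have "x \<in> dom par" "y \<in> ran par" by (auto intro: ranI)
        ultimately show ?thesis using T 0 by (auto simp: ranked_tree_def Rk_def)
      next
        case (Suc j')
        then have "par' j' x = Some y" using \<open>Par j x = Some y\<close> by (simp add: Par_def)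
        then show ?thesis using H Suc by (auto simp: ramsey_hierarchy_def home_def Rk_def)
      qed
      then show "x \<in> X" "y \<in> X" "j \<le> home x" "j \<le> home y" "Rk j y < Rk j x" by auto
    next
      fix j
      show "inj_on (Rk j) {x\<in>X. j \<le> home x}"
      proof (cases j)
        case 0
        then show ?thesis using T by (simp add: Rk_def ranked_tree_def)
      next
        case (Suc j')
        then have "{x\<in>X. j \<le> home x} = {x\<in>X - Y. j' \<le> home' x}" by (auto simp: home_def)
        then show ?thesis using H Suc by (simp add: Rk_def ramsey_hierarchy_def)
      qed
    next
      fix j x assume x: "x \<in> X" "j \<le> home x"
      show "Rk j x < card X"
      proof (cases j)
        case 0
        then show ?thesis using T x by (simp add: Rk_def ranked_tree_def)
      next
        case (Suc j')
        then have "x \<in> X - Y" "j' \<le> home' x" using x by (auto simp: home_def split: if_splits)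
        then have "rk' j' x < card (X - Y)" using H by (simp add: ramsey_hierarchy_def)
        then show ?thesis using Suc smaller by (simp add: Rk_def)
      qed
    next
      fix u v assume uv: "u \<in> X" "v \<in> X"
      consider "u \<in> Y" | "v \<in> Y" | "u \<notin> Y" "v \<notin> Y" by blast
      then show "linked (Par (min (home u) (home v))) u v (64 * real k * d u v)"
      proof cases
        case 1
        then show ?thesis using R(1) uv by (simp add: home_def Par_def ramsey_tree_def)
      next
        case 2
        then have "linked par v u (64 * real k * d v u)" using R(1) uv by (simp add: ramsey_tree_def)
        then show ?thesis using 2 linked_sym dist_sym[of u v] by (simp add: home_def Par_def)
      next
        case 3
        then show ?thesis using H uv by (simp add: ramsey_hierarchy_def home_def Par_def)
      qed
    qed
    moreover have "real (\<Sum>x\<in>X. Suc (home x)) \<le> real (card X) * N powr p"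
    proof -
      \<comment> \<open>Every point of \<open>X\<close> counts once for tree 0, and only the points
        outside \<open>Y\<close> occur in further trees.\<close>
      have "(\<Sum>x\<in>X. Suc (home x)) = card X + (\<Sum>x\<in>X. home x)"
        by (simp add: sum_Suc)
      also have "(\<Sum>x\<in>X. home x) = (\<Sum>x\<in>X - Y. home x) + (\<Sum>x\<in>Y. home x)"
        by (rule sum.subset_diff[OF R(2) less.prems(1)])
      also have "\<dots> = (\<Sum>x\<in>X - Y. Suc (home' x))"
        by (simp add: home_def)
      finally have "real (\<Sum>x\<in>X. Suc (home x)) \<le> real (card X) + real (card (X - Y)) * N powr p"
        using sum' by simp
      also have "real (card X) \<le> real (card Y) * N powr p"
      proof -
        have "real (card X) powr p \<le> N powr p"
          using less.prems(3) by (intro powr_mono2) (auto simp: p_def)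
        then show ?thesis by (intro order_trans[OF R(3) mult_left_mono]) auto
      qed
      also have "real (card Y) * N powr p + real (card (X - Y)) * N powr p = real (card X) * N powr p"
      proof -
        have "card X = card Y + card (X - Y)"
          using card_Diff_subset[OF finY R(2)] card_mono[OF less.prems(1) R(2)] by simp
        then show ?thesis by (simp only: of_nat_add distrib_right)
      qed
      finally show ?thesis by simp
    qed
    ultimately show ?thesis unfolding p_def by blast
  qed
qed

end

section \<open>Graph distances\<close>

lemma path_weight_singleton [simp]: "path_weight G [x] = 0"
  by (simp add: path_weight_def path_length_def)

lemma path_weight_Cons [simp]:
  "path_weight G (x # y # p) = weight G {x, y} + path_weight G (y # p)"
  by (simp add: path_weight_def path_length_def sum.lessThan_Suc_shift del: sum.lessThan_Suc)

lemma path_weight_snoc: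
  "p \<noteq> [] \<Longrightarrow> path_weight G (p @ [v]) = path_weight G p + weight G {last p, v}"
proof (induction p rule: induct_list012)
  case (3 x y zs)
  then show ?case by (simp add: add.assoc)
qed auto

lemma path_weight_rev: "path_weight G (rev p) = path_weight G p"
proof (induction p rule: induct_list012)
  case (3 x y zs)
  then show ?case
    using path_weight_snoc[of "rev (y # zs)" G x] by (simp add: insert_commute)
qed auto

lemma path_weight_nonneg:
  assumes "weighted_graph G" "successively (\<lambda>x y. {x, y} \<in> edges G) p"
  shows "0 \<le> path_weight G p"
  unfolding path_weight_def
proof (rule sum_nonneg)
  fix i assume "i \<in> {..<path_length p}"
  then have "{p ! i, p ! Suc i} \<in> edges G"
    using successively_nth[OF assms(2)] by (auto simp: path_length_def)
  then show "0 \<le> weight G {p ! i, p ! Suc i}" using assms(1) by (simp add: weighted_graph_def)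
qed

lemma is_path_singleton: "u \<in> verts G \<Longrightarrow> is_path G u [u] u"
  by (simp add: is_path_def)

lemma is_path_verts: "is_path G u p v \<Longrightarrow> u \<in> verts G \<and> v \<in> verts G"
  unfolding is_path_def by (metis hd_in_set last_in_set subsetD)

lemma is_path_rev: "is_path G u p v \<Longrightarrow> is_path G v (rev p) u"
  by (auto simp: is_path_def hd_rev last_rev insert_commute)

text \<open>Paths are simple, so \<open>x\<close> cannot be put in front of a path that visits it.
  In that case the part of \<open>q\<close> from \<open>x\<close> onwards serves; nonnegative
  weights make it no heavier.\<close>

lemma is_path_shortcut:
  assumes G: "weighted_graph G" and q: "is_path G y q v" and xy: "{x, y} \<in> edges G" and x: "x \<in> verts G"
  shows "\<exists>q'. is_path G x q' v \<and> path_weight G q' \<le> weight G {x, y} + path_weight G q"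
proof (cases "x \<in> set q")
  case True
  then obtain a b where ab: "q = a @ x # b" by (meson split_list)
  have "is_path G x (x # b) v"
    using q unfolding ab is_path_def by (auto simp: successively_append_iff)
  moreover have "path_weight G (x # b) \<le> path_weight G q"
    using q unfolding ab
  proof (induction a arbitrary: y)
    case (Cons z a)
    obtain z' a' where za: "a @ x # b = z' # a'" by (cases "a @ x # b") auto
    have path: "is_path G z' (a @ x # b) v" and "{z, z'} \<in> edges G"
      using Cons.prems za unfolding is_path_def by auto
    then have "0 \<le> weight G {z, z'}" using G by (simp add: weighted_graph_def)
    then show ?case using Cons.IH[OF path] za by simp
  qed simp
  moreover have "0 \<le> weight G {x, y}" using G xy by (simp add: weighted_graph_def)
  ultimately show ?thesis by (intro exI[of _ "x # b"]) auto
next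
  case False
  obtain q' where q': "q = y # q'" using q unfolding is_path_def by (cases q) auto
  have "is_path G x (x # q) v" using False q xy x q' unfolding is_path_def by auto
  then show ?thesis using q' by (intro exI[of _ "x # q"]) auto
qed

text \<open>The edges of \<open>p\<close> are put in front of \<open>q\<close> one at a time, the
  last one first, and repetitions are cut out as they arise.\<close>

lemma is_path_trans:
  assumes G: "weighted_graph G" and "is_path G u p z" "is_path G z q v"
  shows "\<exists>q'. is_path G u q' v \<and> path_weight G q' \<le> path_weight G p + path_weight G q"
  using assms(2)
proof (induction p arbitrary: u rule: induct_list012)
  case 1
  then show ?case by (simp add: is_path_def)
next
  case (2 x)
  then show ?case using assms(3) by (auto simp: is_path_def)
next
  case (3 x y p)
  then have ux: "u = x" "x \<in> verts G" "{x, y} \<in> edges G" and "is_path G y (y # p) z"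
    by (auto simp: is_path_def)
  then obtain q' where q': "is_path G y q' v" "path_weight G q' \<le> path_weight G (y # p) + path_weight G q"
    using "3.IH"(2) by blast
  then obtain q'' where "is_path G x q'' v" "path_weight G q'' \<le> weight G {x, y} + path_weight G q'"
    using is_path_shortcut[OF G] ux by blast
  then show ?case using q' ux by (intro exI[of _ q'']) auto
qed

lemma gdist_le: "is_path G u p v \<Longrightarrow> gdist G u v \<le> ereal (path_weight G p)"
  unfolding gdist_def by (intro INF_lower) auto

lemma gdist_nonneg: "weighted_graph G \<Longrightarrow> 0 \<le> gdist G u v"
  unfolding gdist_def by (intro INF_greatest) (auto simp: is_path_def intro: path_weight_nonneg)

text \<open>There are only finitely many simple paths, so the infimum over a nonempty set of them is
  a minimum.\<close>

lemma gdist_attained: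
  assumes G: "weighted_graph G" and "gdist G u v \<noteq> \<infinity>"
  obtains p where "is_path G u p v" "gdist G u v = ereal (path_weight G p)"
proof -
  define P where "P = {p. is_path G u p v}"
  have "P \<subseteq> {p. distinct p \<and> set p \<subseteq> verts G}" by (auto simp: P_def is_path_def)
  moreover have "finite {p. distinct p \<and> set p \<subseteq> verts G}"
    using G finite_subset_distinct[of "verts G"]
    by (simp add: weighted_graph_def conj_commute)
  ultimately have fin: "finite P" by (rule finite_subset)
  have "P \<noteq> {}"
  proof
    assume "P = {}"
    then show False using assms(2) by (simp add: gdist_def P_def top_ereal_def)
  qed
  then have "gdist G u v = Min ((\<lambda>p. ereal (path_weight G p)) ` P)"
    using fin by (simp add: gdist_def P_def Min_Inf)
  moreover have "Min ((\<lambda>p. ereal (path_weight G p)) ` P) \<in> (\<lambda>p. ereal (path_weight G p)) ` P"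
    using fin \<open>P \<noteq> {}\<close> by (intro Min_in) auto
  ultimately show thesis using that by (auto simp: P_def)
qed

lemma gdist_self: "weighted_graph G \<Longrightarrow> u \<in> verts G \<Longrightarrow> gdist G u u = 0"
  using gdist_le[OF is_path_singleton, of u G] gdist_nonneg[of G u u]
  by (simp add: zero_ereal_def[symmetric])

lemma gdist_sym: "gdist G u v = gdist G v u"
proof -
  have "gdist G u v \<le> gdist G v u" for u v
    unfolding gdist_def[of G v u]
  proof (rule INF_greatest)
    fix p assume "p \<in> {p. is_path G v p u}"
    then show "gdist G u v \<le> ereal (path_weight G p)"
      using gdist_le[OF is_path_rev] by (simp add: path_weight_rev)
  qed
  then show ?thesis by (simp add: order_antisym)
qed

lemma gdist_triangle:
  assumes G: "weighted_graph G"
  shows "gdist G u v \<le> gdist G u z + gdist G z v"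
proof (cases "gdist G u z = \<infinity> \<or> gdist G z v = \<infinity>")
  case True
  then show ?thesis using gdist_nonneg[OF G, of u z] gdist_nonneg[OF G, of z v] by auto
next
  case False
  obtain p where p: "is_path G u p z" "gdist G u z = ereal (path_weight G p)"
    using gdist_attained[OF G] False by blast
  obtain q where q: "is_path G z q v" "gdist G z v = ereal (path_weight G q)"
    using gdist_attained[OF G] False by blast
  obtain q' where "is_path G u q' v" "path_weight G q' \<le> path_weight G p + path_weight G q"
    using is_path_trans[OF G p(1) q(1)] by blast
  then show ?thesis using gdist_le[of G u q' v] p(2) q(2) by (simp add: order_trans[of _ "ereal (path_weight G q')"])
qed

lemma gdist_finite_trans:
  assumes "weighted_graph G" "gdist G u z \<noteq> \<infinity>" "gdist G z v \<noteq> \<infinity>"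
  shows "gdist G u v \<noteq> \<infinity>"
  using gdist_triangle[OF assms(1), of u v z] assms(2,3) by auto

section \<open>Real-valued distances and components\<close>

text \<open>Region growing needs real distances, so \<open>L\<close> stands in for
  \<open>\<infinity>\<close>. The case \<open>u = v\<close> comes first because outside
  \<open>verts G\<close> even the distance from a point to itself is infinite.\<close>

definition trunc_dist :: "real \<Rightarrow> 'a wgraph \<Rightarrow> 'a \<Rightarrow> 'a \<Rightarrow> real" where
  "trunc_dist L G u v =
     (if u = v then 0 else if gdist G u v = \<infinity> then L else real_of_ereal (gdist G u v))"

lemma gdist_eq_trunc_dist:
  assumes "weighted_graph G" "gdist G u v \<noteq> \<infinity>"
  shows "gdist G u v = ereal (trunc_dist L G u v)"
proof -
  obtain p where p: "is_path G u p v" "gdist G u v = ereal (path_weight G p)"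
    using gdist_attained[OF assms] by blast
  have "u \<in> verts G" using is_path_verts[OF p(1)] by simp
  then show ?thesis using p(2) gdist_self[OF assms(1), of u]
    by (auto simp: trunc_dist_def zero_ereal_def)
qed

text \<open>No value exceeds \<open>L\<close>. A leg of length \<open>L\<close> therefore settles
  the triangle inequality at once, and two finite legs reduce it to the one for
  \<open>gdist\<close>.\<close>

lemma pseudometric_trunc_dist:
  assumes G: "weighted_graph G"
    and L: "0 \<le> L" "\<And>u v. gdist G u v \<noteq> \<infinity> \<Longrightarrow> gdist G u v \<le> ereal L"
  shows "pseudometric (trunc_dist L G)"
proof
  show "trunc_dist L G x x = 0" for x by (simp add: trunc_dist_def)
  show "trunc_dist L G x y = trunc_dist L G y x" for x y
    by (simp add: trunc_dist_def gdist_sym[of G x y])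
  have nonneg: "0 \<le> trunc_dist L G x y" for x y
    using gdist_nonneg[OF G, of x y] L(1) by (auto simp: trunc_dist_def intro: real_of_ereal_pos)
  have le: "trunc_dist L G x y \<le> L" for x y
  proof (cases "gdist G x y = \<infinity>")
    case False
    then show ?thesis using L(2)[of x y] gdist_eq_trunc_dist[OF G False, of L] by simp
  qed (use L(1) in \<open>simp add: trunc_dist_def\<close>)
  show "trunc_dist L G x z \<le> trunc_dist L G x y + trunc_dist L G y z" for x y z
  proof (cases "x = y \<or> y = z")
    case True
    then show ?thesis using nonneg by (auto simp: trunc_dist_def)
  next
    case neq: False
    show ?thesis
    proof (cases "gdist G x y = \<infinity> \<or> gdist G y z = \<infinity>")
      case True
      then have "trunc_dist L G x y = L \<or> trunc_dist L G y z = L"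
        using neq by (auto simp: trunc_dist_def)
      then show ?thesis using le[of x z] nonneg[of x y] nonneg[of y z] by auto
    next
      case False
      then have "gdist G x z \<noteq> \<infinity>" using gdist_finite_trans[OF G] by blast
      then show ?thesis
        using False gdist_triangle[OF G, of x z y] gdist_eq_trunc_dist[OF G, of _ _ L]
        by (metis ereal_less_eq(3) plus_ereal.simps(1))
    qed
  qed
qed

lemma gdist_bounded:
  assumes G: "weighted_graph G"
  obtains b where "0 \<le> b" "\<And>u v. gdist G u v \<noteq> \<infinity> \<Longrightarrow> gdist G u v \<le> ereal b"
proof -
  \<comment> \<open>Inserting 0 gives \<open>Max S\<close> a meaning for the empty graph and makes
    it nonnegative.\<close>
  define S where "S = insert 0 ((\<lambda>(u, v). real_of_ereal (gdist G u v)) ` (verts G \<times> verts G))"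
  have fin: "finite S" using G by (simp add: S_def weighted_graph_def)
  have "gdist G u v \<le> ereal (Max S)" if fin_uv: "gdist G u v \<noteq> \<infinity>" for u v
  proof -
    obtain p where p: "is_path G u p v" "gdist G u v = ereal (path_weight G p)"
      using gdist_attained[OF G fin_uv] by blast
    then have "real_of_ereal (gdist G u v) \<in> S"
      using is_path_verts[OF p(1)] unfolding S_def by (intro insertI2 image_eqI[of _ _ "(u, v)"]) auto
    then show ?thesis using p(2) fin by simp
  qed
  moreover have "0 \<le> Max S" using fin by (auto simp: S_def)
  ultimately show thesis using that by blast
qed

text \<open>Comparing representatives decides connectivity, and the least one is no larger than the
  vertex itself, so it fits into a word.\<close>

definition component :: "nat wgraph \<Rightarrow> nat \<Rightarrow> nat" where
  "component G u = (LEAST v. gdist G u v \<noteq> \<infinity>)"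

lemma component_le:
  assumes "weighted_graph G" "u \<in> verts G"
  shows "component G u \<le> u"
  unfolding component_def using gdist_self[OF assms] by (intro Least_le) simp

lemma component_eq_iff:
  assumes G: "weighted_graph G" and "u \<in> verts G" "v \<in> verts G"
  shows "component G u = component G v \<longleftrightarrow> gdist G u v \<noteq> \<infinity>"
proof
  assume "gdist G u v \<noteq> \<infinity>"
  then have "gdist G u x \<noteq> \<infinity> \<longleftrightarrow> gdist G v x \<noteq> \<infinity>" for x
    using gdist_finite_trans[OF G] gdist_sym[of G u v] by metis
  then show "component G u = component G v" by (simp add: component_def)
next
  assume eq: "component G u = component G v"
  have "gdist G x (component G x) \<noteq> \<infinity>" if "x \<in> verts G" for x
    unfolding component_def by (rule LeastI[of _ x]) (simp add: gdist_self[OF G that])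
  then show "gdist G u v \<noteq> \<infinity>"
    using gdist_finite_trans[OF G] gdist_sym eq assms(2,3) by metis
qed

section \<open>Paths in rooted trees\<close>

text \<open>
  The walk between \<open>u\<close> and \<open>v\<close> always replaces the endpoint of larger rank by its parent,
  since that endpoint cannot be an ancestor of the other one.
\<close>

inductive tree_path :: "('a \<Rightarrow> 'a option) \<Rightarrow> ('a \<Rightarrow> nat) \<Rightarrow> 'a \<Rightarrow> 'a \<Rightarrow> 'a list \<Rightarrow> bool"
  for par rk where
  meet: "tree_path par rk u u [u]"
| up: "u \<noteq> v \<Longrightarrow> \<not> rk u < rk v \<Longrightarrow> par u = Some y \<Longrightarrow> tree_path par rk y v p \<Longrightarrow>
    tree_path par rk u v (u # p)"
| down: "rk u < rk v \<Longrightarrow> par v = Some y \<Longrightarrow> tree_path par rk u y p \<Longrightarrow>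
    tree_path par rk u v (p @ [v])"

lemma tree_path_ends: "tree_path par rk u v p \<Longrightarrow> p \<noteq> [] \<and> hd p = u \<and> last p = v"
  by (induction rule: tree_path.induct) auto

lemma tree_path_successively:
  "tree_path par rk u v p \<Longrightarrow> successively (\<lambda>x y. par x = Some y \<or> par y = Some x) p"
proof (induction rule: tree_path.induct)
  case (up u v y p)
  then show ?case using tree_path_ends[OF up(4)] by (cases p) auto
next
  case (down u v y p)
  then show ?case using tree_path_ends[OF down(3)] by (auto simp: successively_append_iff)
qed simp

lemma tree_path_subset:
  assumes "tree_path par rk u v p" "u \<in> S" "v \<in> S" "\<And>x y. par x = Some y \<Longrightarrow> y \<in> S"
  shows "set p \<subseteq> S"
  using assms(1-3) by (induction rule: tree_path.induct) (auto dest: assms(4))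

text \<open>A replaced end has strictly larger rank than everything on the rest of the walk, so no
  vertex recurs.\<close>

lemma tree_path_distinct:
  assumes "tree_path par rk u v p" "u \<in> S" "v \<in> S" "inj_on rk S"
    and par: "\<And>x y. par x = Some y \<Longrightarrow> y \<in> S \<and> rk y < rk x"
  shows "distinct p \<and> (\<forall>x\<in>set p. rk x \<le> max (rk u) (rk v))"
  using assms(1-3)
proof (induction rule: tree_path.induct)
  case (up u v y p)
  have "y \<in> S" "rk y < rk u" using par up by auto
  moreover have "rk v < rk u" using up assms(4) by (metis inj_onD linorder_neqE_nat)
  ultimately show ?case using up by fastforce
next
  case (down u v y p)
  have "y \<in> S" "rk y < rk v" using par down by auto
  then show ?case using down by fastforce
qed simp

section \<open>Weights of walks in trees\<close>

context pseudometric
begin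

lemma ascent_rank:
  assumes "ascent par x y c" "\<And>x y. par x = Some y \<Longrightarrow> rk y < (rk x :: nat)"
  shows "rk y \<le> rk x"
  using assms(1) by (induction rule: ascent.induct) (auto dest: assms(2))

text \<open>The rank of \<open>z\<close> is at most that of either end, so the end of larger rank is
  not \<open>z\<close>. Its ascent begins with a parent step, and \<open>z\<close> stays a common
  ancestor. Meeting before \<open>z\<close> only saves cost.\<close>

lemma tree_path_exists:
  assumes "ascent par u z a" "ascent par v z b" "u \<in> S" "v \<in> S" "inj_on rk S"
    and par: "\<And>x y. par x = Some y \<Longrightarrow> y \<in> S \<and> rk y < (rk x :: nat)"
    and H: "\<And>x y. weight H {x, y} = d x y"
  shows "\<exists>p. tree_path par rk u v p \<and> path_weight H p \<le> a + b"
  using assms(1-4)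
proof (induction "rk u + rk v" arbitrary: u v a b rule: less_induct)
  case less
  have mono: "rk y \<le> rk x" if "ascent par x y c" for x y c
    using ascent_rank[OF that] par by blast
  consider "u = v" | "u \<noteq> v" "rk v < rk u" | "rk u < rk v"
    using assms(5) less.prems by (metis inj_onD linorder_neqE_nat)
  then show ?case
  proof cases
    case 1
    then show ?thesis
      using tree_path.meet[of par rk u] ascent_nonneg[OF less.prems(1)] ascent_nonneg[OF less.prems(2)]
      by (intro exI[of _ "[u]"]) auto
  next
    case 2
    have "u \<noteq> z" using mono[OF less.prems(2)] 2 by auto
    with less.prems(1) obtain y c where y: "par u = Some y" "ascent par y z c" "a = d u y + c"
      by (auto elim: ascent.cases)
    have "rk y + rk v < rk u + rk v" "y \<in> S" using par[OF y(1)] by auto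
    from less.hyps[OF this(1) y(2) less.prems(2) this(2) less.prems(4)]
    obtain p where p: "tree_path par rk y v p" "path_weight H p \<le> c + b" by blast
    have "tree_path par rk u v (u # p)" using 2 y(1) p(1) by (intro tree_path.up) auto
    moreover obtain p' where "p = y # p'" using tree_path_ends[OF p(1)] by (cases p) auto
    ultimately show ?thesis using p(2) y(3) H by (intro exI[of _ "u # p"]) auto
  next
    case 3
    have "v \<noteq> z" using mono[OF less.prems(1)] 3 by auto
    with less.prems(2) obtain y c where y: "par v = Some y" "ascent par y z c" "b = d v y + c"
      by (auto elim: ascent.cases)
    have "rk u + rk y < rk u + rk v" "y \<in> S" using par[OF y(1)] by auto
    from less.hyps[OF this(1) less.prems(1) y(2) less.prems(3) this(2)]
    obtain p where p: "tree_path par rk u y p" "path_weight H p \<le> a + c" by blast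
    have "tree_path par rk u v (p @ [v])" using 3 y(1) p(1) by (intro tree_path.down) auto
    moreover have "path_weight H (p @ [v]) = path_weight H p + d y v"
      using tree_path_ends[OF p(1)] H by (simp add: path_weight_snoc)
    ultimately show ?thesis using p(2) y(3) dist_sym[of v y] by (intro exI[of _ "p @ [v]"]) auto
  qed
qed

text \<open>Lets \<open>diam\<close> serve as a weight function on edges without choosing an
  orientation.\<close>

lemma diam_pair: "diam {x, y} = d x y"
proof -
  have "(\<lambda>(x, y). d x y) ` ({x, y} \<times> {x, y}) = {0, d x y}" using dist_sym[of x y] by auto
  then show ?thesis by (simp add: diam_def)
qed

lemma dist_le_path_weight:
  assumes "\<And>x y. weight H {x, y} = d x y" "p \<noteq> []"
  shows "d (hd p) (last p) \<le> path_weight H p"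
  using assms(2)
proof (induction p rule: induct_list012)
  case (3 x y p)
  then show ?case using dist_triangle[of x "last (y # p)" y] assms(1) by fastforce
qed auto

text \<open>Rules out a step of length \<open>L\<close> in a walk of total weight below
  \<open>L\<close>.\<close>

lemma step_le_path_weight:
  assumes "\<And>x y. weight H {x, y} = d x y"
  shows "successively (\<lambda>x y. d x y \<le> path_weight H p) p"
  unfolding successively_conv_nth
proof (intro allI impI)
  fix i assume "Suc i < length p"
  then have "(\<lambda>i. weight H {p ! i, p ! Suc i}) i \<le> path_weight H p"
    unfolding path_weight_def
    by (intro member_le_sum) (auto simp: path_length_def assms)
  then show "d (p ! i) (p ! Suc i) \<le> path_weight H p" by (simp add: assms)
qed

end

section \<open>The query program\<close>

text \<open>
  Registers 0 and 1 hold the two ends of the walk, 5 the offset of the records of the chosen tree,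
  7 and 8 the constants 1 and 0, and 10 the height of a stack in the scratch memory. The loop at 14
  either pushes and moves the end in register 1 (27) or reports and moves the end in register 0
  (31); once the ends meet, the stack is reported from its top (34).
\<close>

definition query_prog :: "instr list" where
  "query_prog = [
     Read 2 0, Read 3 1, Read 4 2, Read 5 3, Bin Eq 6 4 5, Jump_Zero 6 39,
     Const 7 1, Bin Plus 2 2 7, Bin Plus 3 3 7, Read 4 2, Read 5 3,
     Bin Less 6 4 5, Jump_Zero 6 14, Bin Plus 5 4 8,
     Bin Eq 6 0 1, Jump_Zero 6 17, Jump_Zero 8 34,
     Read 2 0, Bin Plus 2 2 5, Read 3 1, Bin Plus 3 3 5,
     Bin Plus 4 2 7, Read 4 4, Bin Plus 9 3 7, Read 9 9, Bin Less 6 4 9, Jump_Zero 6 31,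
     Store 10 1, Bin Plus 10 10 7, Read 1 3, Jump_Zero 8 14,
     Emit 0, Read 0 2, Jump_Zero 8 14,
     Emit 0, Jump_Zero 10 39, Bin Minus 10 10 7, Load 0 10, Jump_Zero 8 34]"

section \<open>Executing the query program\<close>

lemma length_query_prog: "length query_prog = 39"
  by (simp add: query_prog_def)

lemma step_query_prog:
  "i < 39 \<Longrightarrow> step w query_prog D \<lparr>pc = i, regs = R, scratch = S, outp = out\<rparr> =
     exec w D (query_prog ! i) \<lparr>pc = i, regs = R, scratch = S, outp = out\<rparr>"
  by (simp add: step_def halted_def length_query_prog)

lemma query_prog_nth:
  "query_prog ! 0 = Read 2 0" "query_prog ! Suc 0 = Read 3 1" "query_prog ! 1 = Read 3 1" "query_prog ! 2 = Read 4 2"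
  "query_prog ! 3 = Read 5 3" "query_prog ! 4 = Bin Eq 6 4 5" "query_prog ! 5 = Jump_Zero 6 39"
  "query_prog ! 6 = Const 7 1" "query_prog ! 7 = Bin Plus 2 2 7" "query_prog ! 8 = Bin Plus 3 3 7"
  "query_prog ! 9 = Read 4 2" "query_prog ! 10 = Read 5 3" "query_prog ! 11 = Bin Less 6 4 5"
  "query_prog ! 12 = Jump_Zero 6 14" "query_prog ! 13 = Bin Plus 5 4 8"
  "query_prog ! 14 = Bin Eq 6 0 1" "query_prog ! 15 = Jump_Zero 6 17"
  "query_prog ! 16 = Jump_Zero 8 34" "query_prog ! 17 = Read 2 0"
  "query_prog ! 18 = Bin Plus 2 2 5" "query_prog ! 19 = Read 3 1"
  "query_prog ! 20 = Bin Plus 3 3 5" "query_prog ! 21 = Bin Plus 4 2 7"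
  "query_prog ! 22 = Read 4 4" "query_prog ! 23 = Bin Plus 9 3 7" "query_prog ! 24 = Read 9 9"
  "query_prog ! 25 = Bin Less 6 4 9" "query_prog ! 26 = Jump_Zero 6 31"
  "query_prog ! 27 = Store 10 1" "query_prog ! 28 = Bin Plus 10 10 7" "query_prog ! 29 = Read 1 3"
  "query_prog ! 30 = Jump_Zero 8 14" "query_prog ! 31 = Emit 0" "query_prog ! 32 = Read 0 2"
  "query_prog ! 33 = Jump_Zero 8 14" "query_prog ! 34 = Emit 0" "query_prog ! 35 = Jump_Zero 10 39"
  "query_prog ! 36 = Bin Minus 10 10 7" "query_prog ! 37 = Load 0 10"
  "query_prog ! 38 = Jump_Zero 8 34"
  by (simp_all add: query_prog_def)

text \<open>The first step is peeled off, not the last, so that each instruction acts on an explicit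
  configuration.\<close>

lemma funpow_step_Suc: "(step w prog D ^^ Suc t) c = (step w prog D ^^ t) (step w prog D c)"
  by (simp only: funpow_Suc_right o_apply)

lemma funpow_step_numeral:
  "(step w prog D ^^ numeral m) c = (step w prog D ^^ pred_numeral m) (step w prog D c)"
  by (simp only: numeral_eq_Suc funpow_step_Suc)

lemma funpow_step_add:
  "(step w prog D ^^ (s + t)) c = (step w prog D ^^ s) ((step w prog D ^^ t) c)"
  by (simp add: funpow_add)

lemma funpow_step_1: "(step w prog D ^^ 1) c = step w prog D c"
  by simp

lemmas run_simps = funpow_step_1 step_query_prog query_prog_nth funpow_step_Suc funpow_step_numeral

text \<open>Popping one stack cell takes five instructions, the final report with its exit test two.
  The induction removes the last element of \<open>stk\<close>, which is the top of the
  stack.\<close>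

lemma unwind:
  assumes "R 0 = x" "R 7 = 1" "R 8 = 0" "R 10 = length stk" "length stk < 2 ^ w"
    and "\<And>i. i < length stk \<Longrightarrow> S i = stk ! i"
  shows "\<exists>c. (step w query_prog D ^^ (2 + 5 * length stk))
             \<lparr>pc = 34, regs = R, scratch = S, outp = out\<rparr> = c \<and>
           halted query_prog c \<and> outp c = out @ x # rev stk"
  using assms
proof (induction stk arbitrary: x R out rule: rev_induct)
  case Nil
  then show ?case
    by (auto simp: run_simps halted_def length_query_prog)
next
  case (snoc y stk)
  have mod: "(length stk + 2 ^ w) mod 2 ^ w = length stk" using snoc.prems by simp
  have y: "S (length stk) = y" using snoc.prems(6)[of "length stk"] by simp
  define R' where "R' = R(10 := length stk, 0 := y)"
  have *: "(step w query_prog D ^^ 5) \<lparr>pc = 34, regs = R, scratch = S, outp = out\<rparr> =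
      \<lparr>pc = 34, regs = R', scratch = S, outp = out @ [x]\<rparr>"
    using snoc.prems(1-5) mod y by (simp add: run_simps R'_def)
  have "S i = stk ! i" if "i < length stk" for i
    using snoc.prems(6)[of i] that by (simp add: nth_append)
  then have "\<exists>c. (step w query_prog D ^^ (2 + 5 * length stk))
             \<lparr>pc = 34, regs = R', scratch = S, outp = out @ [x]\<rparr> = c \<and>
           halted query_prog c \<and> outp c = (out @ [x]) @ y # rev stk"
    using snoc.prems by (intro snoc.IH) (auto simp: R'_def)
  moreover have "2 + 5 * length (stk @ [y]) = 2 + 5 * length stk + 5" by simp
  ultimately show ?case using * by (simp only: funpow_step_add) simp
qed

text \<open>
  \<open>D ! v\<close> is the address of the block of the vertex \<open>v\<close>. The block starts with the component of
  \<open>v\<close> and the offset of its record for the tree \<open>home v\<close>; the record for the tree \<open>j \<le> home v\<close>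
  has offset \<open>2 * j + 2\<close> and consists of the parent and the rank of \<open>v\<close> in that tree.
\<close>

definition encodes ::
  "nat \<Rightarrow> nat list \<Rightarrow> nat \<Rightarrow> (nat \<Rightarrow> nat) \<Rightarrow> (nat \<Rightarrow> nat) \<Rightarrow> (nat \<Rightarrow> nat \<Rightarrow> nat option) \<Rightarrow>
   (nat \<Rightarrow> nat \<Rightarrow> nat) \<Rightarrow> bool" where
  "encodes w D n cid home par rk \<longleftrightarrow>
     2 \<le> w \<and> n < 2 ^ w \<and> length D < 2 ^ w \<and> n \<le> length D \<and>
     (\<forall>v<n. D ! v + 2 * home v + 3 < length D \<and> D ! (D ! v) = cid v \<and>
        D ! (D ! v + 1) = 2 * home v + 2 \<and>
        (\<forall>j\<le>home v. (\<forall>y. par j v = Some y \<longrightarrow> D ! (D ! v + (2 * j + 2)) = y) \<and>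
                     D ! (D ! v + (2 * j + 2) + 1) = rk j v))"

lemma run_up:
  assumes E: "encodes w D n cid home par rk"
    and uv: "u < n" "v < n" "j \<le> home u" "j \<le> home v" "u \<noteq> v" "\<not> rk j u < rk j v" "par j u = Some y"
    and R: "R 0 = u" "R 1 = v" "R 5 = 2 * j + 2" "R 7 = 1" "R 8 = 0" "R 10 = m"
  shows "\<exists>R'. (step w query_prog D ^^ 15) \<lparr>pc = 14, regs = R, scratch = S, outp = out\<rparr> =
      \<lparr>pc = 14, regs = R', scratch = S, outp = out @ [u]\<rparr> \<and>
      R' 0 = y \<and> R' 1 = v \<and> R' 5 = 2 * j + 2 \<and> R' 7 = 1 \<and> R' 8 = 0 \<and> R' 10 = m"
proof -
  have len: "n \<le> length D" "length D < 2 ^ w"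
    "D ! u + 2 * home u + 3 < length D" "D ! v + 2 * home v + 3 < length D"
    using E uv by (auto simp: encodes_def)
  have mem: "u < length D" "v < length D"
    "D ! u + (2 * j + 2) < length D" "D ! u + (2 * j + 2) + 1 < length D"
    "D ! v + (2 * j + 2) < length D" "D ! v + (2 * j + 2) + 1 < length D"
    using len uv by auto
  have mod: "(D ! u + (2 * j + 2)) mod 2 ^ w = D ! u + (2 * j + 2)"
    "(D ! u + (2 * j + 2) + 1) mod 2 ^ w = D ! u + (2 * j + 2) + 1"
    "(D ! v + (2 * j + 2)) mod 2 ^ w = D ! v + (2 * j + 2)"
    "(D ! v + (2 * j + 2) + 1) mod 2 ^ w = D ! v + (2 * j + 2) + 1"
    using mem len by (intro mod_less; linarith)+
  have val: "D ! (D ! u + (2 * j + 2)) = y" "D ! (D ! u + (2 * j + 2) + 1) = rk j u"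
    "D ! (D ! v + (2 * j + 2) + 1) = rk j v"
    using E uv unfolding encodes_def by blast+
  \<comment> \<open>Opaque names for the two record addresses keep the address arithmetic in the
    form in which \<open>facts\<close> states it.\<close>
  define a where "a = D ! u + (2 * j + 2)"
  define b where "b = D ! v + (2 * j + 2)"
  note facts = mem[folded a_def b_def] mod[folded a_def b_def] val[folded a_def b_def]
    a_def[symmetric] b_def[symmetric]
  show ?thesis
    using uv R by (simp add: run_simps facts del: add_2_eq_Suc add_2_eq_Suc' One_nat_def)
qed

lemma run_down:
  assumes E: "encodes w D n cid home par rk"
    and uv: "u < n" "v < n" "j \<le> home u" "j \<le> home v" "u \<noteq> v" "rk j u < rk j v" "par j v = Some y"
    and R: "R 0 = u" "R 1 = v" "R 5 = 2 * j + 2" "R 7 = 1" "R 8 = 0" "R 10 = m"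
    and m: "m + 1 < 2 ^ w"
  shows "\<exists>R'. (step w query_prog D ^^ 16) \<lparr>pc = 14, regs = R, scratch = S, outp = out\<rparr> =
      \<lparr>pc = 14, regs = R', scratch = S(m := v), outp = out\<rparr> \<and>
      R' 0 = u \<and> R' 1 = y \<and> R' 5 = 2 * j + 2 \<and> R' 7 = 1 \<and> R' 8 = 0 \<and> R' 10 = m + 1"
proof -
  have len: "n \<le> length D" "length D < 2 ^ w"
    "D ! u + 2 * home u + 3 < length D" "D ! v + 2 * home v + 3 < length D"
    using E uv by (auto simp: encodes_def)
  have mem: "u < length D" "v < length D"
    "D ! u + (2 * j + 2) < length D" "D ! u + (2 * j + 2) + 1 < length D"
    "D ! v + (2 * j + 2) < length D" "D ! v + (2 * j + 2) + 1 < length D"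
    using len uv by auto
  have w: "(1 :: nat) mod 2 ^ w = 1" using E by (simp add: encodes_def)
  have mod: "(D ! u + (2 * j + 2)) mod 2 ^ w = D ! u + (2 * j + 2)"
    "(D ! u + (2 * j + 2) + 1) mod 2 ^ w = D ! u + (2 * j + 2) + 1"
    "(D ! v + (2 * j + 2)) mod 2 ^ w = D ! v + (2 * j + 2)"
    "(D ! v + (2 * j + 2) + 1) mod 2 ^ w = D ! v + (2 * j + 2) + 1"
    using mem len by (intro mod_less; linarith)+
  have val: "D ! (D ! v + (2 * j + 2)) = y" "D ! (D ! u + (2 * j + 2) + 1) = rk j u"
    "D ! (D ! v + (2 * j + 2) + 1) = rk j v"
    using E uv unfolding encodes_def by blast+
  define a where "a = D ! u + (2 * j + 2)"
  define b where "b = D ! v + (2 * j + 2)"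
  note facts = mem[folded a_def b_def] mod[folded a_def b_def] val[folded a_def b_def]
    a_def[symmetric] b_def[symmetric]
  show ?thesis
    using uv R m w by (simp add: run_simps facts del: add_2_eq_Suc add_2_eq_Suc' One_nat_def)
qed

text \<open>Moving the left end costs 15 steps; moving the right end costs 16 and later 5 more to
  pop the vertex, hence at most 21 per vertex. The meeting vertex needs only 5 steps, which leaves a
  reserve of 16 for the header.\<close>

lemma run_tree_path:
  assumes E: "encodes w D n cid home par rk"
    and par: "\<forall>x y. par j x = Some y \<longrightarrow> y < n \<and> j \<le> home y"
    and path: "tree_path (par j) (rk j) u v p"
    and uv: "u < n" "v < n" "j \<le> home u" "j \<le> home v"
    and R: "R 0 = u" "R 1 = v" "R 5 = 2 * j + 2" "R 7 = 1" "R 8 = 0" "R 10 = length stk"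
    and stk: "length stk + length p < 2 ^ w" "\<And>i. i < length stk \<Longrightarrow> S i = stk ! i"
  shows "\<exists>c t. (step w query_prog D ^^ t) \<lparr>pc = 14, regs = R, scratch = S, outp = out\<rparr> = c \<and>
           halted query_prog c \<and> outp c = out @ p @ rev stk \<and>
           t + 16 \<le> 21 * length p + 5 * length stk"
  using path uv R stk
proof (induction arbitrary: R S out stk rule: tree_path.induct)
  case (meet u)
  define R' where "R' = R(6 := 1)"
  have w: "0 < w" "(1 :: nat) mod 2 ^ w = 1" using E by (auto simp: encodes_def)
  have start: "(step w query_prog D ^^ 3) \<lparr>pc = 14, regs = R, scratch = S, outp = out\<rparr> =
      \<lparr>pc = 34, regs = R', scratch = S, outp = out\<rparr>"
    using meet w by (simp add: run_simps R'_def)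
  obtain c where c: "(step w query_prog D ^^ (2 + 5 * length stk))
      \<lparr>pc = 34, regs = R', scratch = S, outp = out\<rparr> = c"
    "halted query_prog c" "outp c = out @ u # rev stk"
    using unwind[of R' u stk w S D out] meet by (auto simp: R'_def)
  have "(step w query_prog D ^^ (2 + 5 * length stk + 3))
      \<lparr>pc = 14, regs = R, scratch = S, outp = out\<rparr> = c"
    by (subst funpow_step_add) (simp only: start c(1))
  then show ?case using c(2,3)
    by (intro exI[of _ c] exI[of _ "2 + 5 * length stk + 3"] conjI) simp_all
next
  case (up u v y p)
  obtain R' where R': "(step w query_prog D ^^ 15) \<lparr>pc = 14, regs = R, scratch = S, outp = out\<rparr> =
      \<lparr>pc = 14, regs = R', scratch = S, outp = out @ [u]\<rparr>"
      "R' 0 = y" "R' 1 = v" "R' 5 = 2 * j + 2" "R' 7 = 1" "R' 8 = 0" "R' 10 = length stk"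
    using run_up[where S = S and out = out, OF E up.prems(1-4) up.hyps(1-3) up.prems(5-10)] by blast
  have y: "y < n" "j \<le> home y" using par up.hyps(3) by auto
  have len: "length stk + length p < 2 ^ w" using up.prems(11) by simp
  obtain c t where c: "(step w query_prog D ^^ t)
      \<lparr>pc = 14, regs = R', scratch = S, outp = out @ [u]\<rparr> = c"
      "halted query_prog c" "outp c = (out @ [u]) @ p @ rev stk"
      "t + 16 \<le> 21 * length p + 5 * length stk"
    using up.IH[OF y(1) up.prems(2) y(2) up.prems(4) R'(2-7) len up.prems(12), of "out @ [u]"] by blast
  then show ?case using R'(1)
    by (intro exI[of _ c] exI[of _ "t + 15"]) (auto simp: funpow_step_add)
next
  case (down u v y p)
  have m: "length stk + 1 < 2 ^ w" using down.prems(11) by simp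
  obtain R' where R': "(step w query_prog D ^^ 16) \<lparr>pc = 14, regs = R, scratch = S, outp = out\<rparr> =
      \<lparr>pc = 14, regs = R', scratch = S(length stk := v), outp = out\<rparr>"
      "R' 0 = u" "R' 1 = y" "R' 5 = 2 * j + 2" "R' 7 = 1" "R' 8 = 0" "R' 10 = length stk + 1"
    using run_down[where S = S and out = out, OF E down.prems(1-4) _ down.hyps(1,2) down.prems(5-10) m]
      down.hyps(1) by blast
  have y: "y < n" "j \<le> home y" using par down.hyps(2) by auto
  have top: "R' 10 = length (stk @ [v])" using R'(7) by simp
  have len: "length (stk @ [v]) + length p < 2 ^ w" using down.prems(11) by simp
  have S: "(S(length stk := v)) i = (stk @ [v]) ! i" if "i < length (stk @ [v])" for i
    using that down.prems(12)[of i] by (auto simp: nth_append less_Suc_eq)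
  obtain c t where c: "(step w query_prog D ^^ t)
      \<lparr>pc = 14, regs = R', scratch = S(length stk := v), outp = out\<rparr> = c"
      "halted query_prog c" "outp c = out @ p @ rev (stk @ [v])"
      "t + 16 \<le> 21 * length p + 5 * length (stk @ [v])"
    using down.IH[OF down.prems(1) y(1) down.prems(3) y(2) R'(2-6) top len S, of out] by blast
  then show ?case using R'(1)
    by (intro exI[of _ c] exI[of _ "t + 16"]) (auto simp: funpow_step_add)
qed

lemma run_header_disconnected:
  assumes E: "encodes w D n cid home par rk" and uv: "u < n" "v < n" and "cid u \<noteq> cid v"
  shows "answers_within w query_prog D u v 6 []"
proof -
  have len: "u < length D" "v < length D" "D ! u < length D" "D ! v < length D"
    and val: "D ! (D ! u) = cid u" "D ! (D ! v) = cid v"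
    using E uv by (auto simp: encodes_def add_lessD1)
  show ?thesis
    using assms(4) len val
    by (simp add: answers_within_def init_def run_simps halted_def length_query_prog
        One_nat_def[symmetric] Suc_1 del: One_nat_def)
qed

text \<open>The header keeps the smaller of the two record offsets, which is the one for the smaller
  home index. Register 8 holds 0, so adding it to register 4 makes a copy.\<close>

lemma run_header_connected:
  assumes E: "encodes w D n cid home par rk" and uv: "u < n" "v < n" and cid: "cid u = cid v"
  shows "\<exists>t R. (step w query_prog D ^^ t) (init u v) =
      \<lparr>pc = 14, regs = R, scratch = \<lambda>_. 0, outp = []\<rparr> \<and> t \<le> 14 \<and>
      R 0 = u \<and> R 1 = v \<and> R 5 = 2 * min (home u) (home v) + 2 \<and> R 7 = 1 \<and> R 8 = 0 \<and> R 10 = 0"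
proof -
  have D: "length D < 2 ^ w" "n \<le> length D" "D ! u + 2 * home u + 3 < length D" "D ! v + 2 * home v + 3 < length D"
    and val: "D ! (D ! u) = cid u" "D ! (D ! v) = cid v"
      "D ! (D ! u + 1) = 2 * home u + 2" "D ! (D ! v + 1) = 2 * home v + 2"
    using E uv by (auto simp: encodes_def)
  have len: "u < length D" "v < length D" "D ! u < length D" "D ! v < length D"
      "D ! u + 1 < length D" "D ! v + 1 < length D"
    using D uv by auto
  have mod: "(D ! u + 1) mod 2 ^ w = D ! u + 1" "(D ! v + 1) mod 2 ^ w = D ! v + 1"
    "(2 * home u + 2) mod 2 ^ w = 2 * home u + 2"
    using D by (intro mod_less; linarith)+
  have w: "0 < w" "(1 :: nat) mod 2 ^ w = 1" using E by (auto simp: encodes_def)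
  define a where "a = 2 * home u + 2"
  define b where "b = 2 * home v + 2"
  note facts = len mod[folded a_def] val[folded a_def b_def] w cid a_def[symmetric] b_def[symmetric]
  have ab: "2 * min (home u) (home v) + 2 = min a b" by (auto simp: a_def b_def)
  show ?thesis
  proof (cases "a < b")
    case True
    then show ?thesis unfolding ab init_def
      by (intro exI[of _ 14]) (simp add: run_simps facts One_nat_def[symmetric] Suc_1
          del: add_2_eq_Suc add_2_eq_Suc' One_nat_def)
  next
    case False
    then show ?thesis unfolding ab init_def
      by (intro exI[of _ 13]) (simp add: run_simps facts One_nat_def[symmetric] Suc_1
          del: add_2_eq_Suc add_2_eq_Suc' One_nat_def)
  qed
qed

lemma answers_within_tree_path:
  assumes E: "encodes w D n cid home par rk" and uv: "u < n" "v < n" and cid: "cid u = cid v"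
    and par: "\<forall>x y. par (min (home u) (home v)) x = Some y \<longrightarrow> y < n \<and> min (home u) (home v) \<le> home y"
    and path: "tree_path (par (min (home u) (home v))) (rk (min (home u) (home v))) u v p"
    and len: "length p \<le> n"
  shows "\<exists>t. answers_within w query_prog D u v t p \<and> real t \<le> 21 * (1 + real (path_length p))"
proof -
  obtain t R where R: "(step w query_prog D ^^ t) (init u v) =
      \<lparr>pc = 14, regs = R, scratch = \<lambda>_. 0, outp = []\<rparr>" "t \<le> 14"
      "R 0 = u" "R 1 = v" "R 5 = 2 * min (home u) (home v) + 2" "R 7 = 1" "R 8 = 0" "R 10 = length ([] :: nat list)"
    using run_header_connected[OF E uv cid] by auto
  have "length ([] :: nat list) + length p < 2 ^ w" using len E by (simp add: encodes_def)
  from run_tree_path[where S = "\<lambda>_. 0" and out = "[]" and stk = "[]", OF E par path uv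
      min.cobounded1 min.cobounded2 R(3-8) this]
  obtain c t' where c: "(step w query_prog D ^^ t')
      \<lparr>pc = 14, regs = R, scratch = \<lambda>_. 0, outp = []\<rparr> = c"
      "halted query_prog c" "outp c = p" "t' + 16 \<le> 21 * length p"
    by auto
  have "(step w query_prog D ^^ (t' + t)) (init u v) = c"
    using R(1) c(1) by (simp add: funpow_step_add)
  then have "answers_within w query_prog D u v (t' + t) p"
    using c by (simp add: answers_within_def)
  \<comment> \<open>The 14 header steps fit into the reserve of 16, and
    \<open>1 + path_length p\<close> equals \<open>length p\<close> because \<open>p\<close> is
    nonempty.\<close>
  moreover have "real (t' + t) \<le> 21 * (1 + real (path_length p))"
    using c(4) R(2) by (simp add: path_length_def)
  ultimately show ?thesis by blast
qed

section \<open>The data structure\<close>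

lemma nth_concat_upt:
  assumes "i < n" "k < length (f i)"
  shows "(\<Sum>m<i. length (f m)) + k < length (concat (map f [0..<n]))"
    and "concat (map f [0..<n]) ! ((\<Sum>m<i. length (f m)) + k) = f i ! k"
proof -
  have len: "length (concat (map f [0..<m])) = (\<Sum>i<m. length (f i))" for m
    by (induction m) auto
  have *: "(\<Sum>m<i. length (f m)) + k < length (concat (map f [0..<n])) \<and>
      concat (map f [0..<n]) ! ((\<Sum>m<i. length (f m)) + k) = f i ! k"
    using assms(1)
  proof (induction n)
    case (Suc n)
    show ?case
    proof (cases "i = n")
      case True
      then show ?thesis using assms(2) by (simp add: len[symmetric] nth_append)
    next
      case False
      then show ?thesis using Suc by (simp add: nth_append)
    qed
  qed simp
  from * show "(\<Sum>m<i. length (f m)) + k < length (concat (map f [0..<n]))"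
    and "concat (map f [0..<n]) ! ((\<Sum>m<i. length (f m)) + k) = f i ! k" by auto
qed

text \<open>A root has no parent; the placeholder 0 keeps every record two words wide, so that
  offsets are linear in \<open>j\<close>.\<close>

definition block ::
  "(nat \<Rightarrow> nat) \<Rightarrow> (nat \<Rightarrow> nat) \<Rightarrow> (nat \<Rightarrow> nat \<Rightarrow> nat option) \<Rightarrow> (nat \<Rightarrow> nat \<Rightarrow> nat) \<Rightarrow> nat \<Rightarrow> nat list" where
  "block cid home par rk v = cid v # (2 * home v + 2) #
     concat (map (\<lambda>j. [case par j v of None \<Rightarrow> 0 | Some y \<Rightarrow> y, rk j v]) [0..<Suc (home v)])"

text \<open>The blocks differ in length, hence the leading table of addresses.\<close>

definition query_data ::
  "nat \<Rightarrow> (nat \<Rightarrow> nat) \<Rightarrow> (nat \<Rightarrow> nat) \<Rightarrow> (nat \<Rightarrow> nat \<Rightarrow> nat option) \<Rightarrow> (nat \<Rightarrow> nat \<Rightarrow> nat) \<Rightarrow> nat list" where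
  "query_data n cid home par rk =
     map (\<lambda>v. n + (\<Sum>u<v. length (block cid home par rk u))) [0..<n] @
     concat (map (block cid home par rk) [0..<n])"

lemma length_block: "length (block cid home par rk v) = 2 * home v + 4"
  by (simp add: block_def length_concat o_def sum_list_triv)

lemma length_query_data:
  "length (query_data n cid home par rk) = 3 * n + 2 * (\<Sum>v<n. Suc (home v))"
proof -
  have "length (concat (map (block cid home par rk) [0..<n])) = 2 * n + 2 * (\<Sum>v<n. Suc (home v))"
    by (induction n) (auto simp: length_block)
  then show ?thesis by (simp add: query_data_def)
qed

lemma block_nth:
  assumes "j \<le> home v"
  shows "block cid home par rk v ! (2 * j + 2) = (case par j v of None \<Rightarrow> 0 | Some y \<Rightarrow> y)"
    and "block cid home par rk v ! (2 * j + 2 + 1) = rk j v"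
proof -
  define f where "f = (\<lambda>j. [case par j v of None \<Rightarrow> 0 | Some y \<Rightarrow> y, rk j v])"
  have sum: "(\<Sum>m<j. length (f m)) = 2 * j" by (simp add: f_def)
  have j: "j < Suc (home v)" using assms by simp
  have "concat (map f [0..<Suc (home v)]) ! (2 * j + 0) = f j ! 0"
    and "concat (map f [0..<Suc (home v)]) ! (2 * j + 1) = f j ! 1"
    using nth_concat_upt(2)[of j "Suc (home v)" 0 f] nth_concat_upt(2)[of j "Suc (home v)" 1 f] j
    unfolding sum by (auto simp: f_def)
  then show "block cid home par rk v ! (2 * j + 2) = (case par j v of None \<Rightarrow> 0 | Some y \<Rightarrow> y)"
    and "block cid home par rk v ! (2 * j + 2 + 1) = rk j v"
    by (simp_all add: block_def f_def del: upt_Suc)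
qed

lemma encodes_query_data:
  assumes "2 \<le> w" "length (query_data n cid home par rk) < 2 ^ w"
  shows "encodes w (query_data n cid home par rk) n cid home par rk"
proof -
  define D where "D = query_data n cid home par rk"
  define blk where "blk = block cid home par rk"
  have n: "n \<le> length D" by (simp add: D_def query_data_def)
  have base: "D ! v = n + (\<Sum>u<v. length (blk u))" if "v < n" for v
    using that by (simp add: D_def query_data_def nth_append blk_def)
  have at: "D ! v + i < length D \<and> D ! (D ! v + i) = blk v ! i" if v: "v < n" and i: "i < length (blk v)" for v i
  proof -
    have "D = map (\<lambda>v. n + (\<Sum>u<v. length (blk u))) [0..<n] @ concat (map blk [0..<n])"
      by (simp add: D_def query_data_def blk_def)
    moreover have "D ! v + i = n + ((\<Sum>u<v. length (blk u)) + i)" using base[OF v] by simp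
    ultimately show ?thesis
      using nth_concat_upt[of v n i blk, OF v i] by (metis (no_types, lifting) add_less_cancel_left diff_zero length_append
          length_map length_upt nth_append_length_plus)
  qed
  have len: "length (blk v) = 2 * home v + 4" for v by (simp add: blk_def length_block)
  have "encodes w D n cid home par rk"
    unfolding encodes_def
  proof (intro conjI allI impI)
    fix v assume v: "v < n"
    show "D ! v + 2 * home v + 3 < length D" using at[OF v, of "2 * home v + 3"] len by (simp add: add.assoc)
    show "D ! (D ! v) = cid v" using at[OF v, of 0] len by (simp add: blk_def block_def)
    show "D ! (D ! v + 1) = 2 * home v + 2" using at[OF v, of 1] len by (simp add: blk_def block_def)
    fix j assume j: "j \<le> home v"
    show "D ! (D ! v + (2 * j + 2) + 1) = rk j v"
      using at[OF v, of "2 * j + 2 + 1"] len j block_nth(2)[of j home v cid par rk]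
      by (simp add: blk_def add.assoc)
    fix y assume "par j v = Some y"
    then show "D ! (D ! v + (2 * j + 2)) = y"
      using at[OF v, of "2 * j + 2"] len j block_nth(1)[of j home v cid par rk] by (simp add: blk_def)
  qed (use assms n in \<open>auto simp: D_def\<close>)
  then show ?thesis by (simp add: D_def)
qed

text \<open>Ensures that a word size sufficient for addressing the data also holds every address,
  offset, vertex and rank stored in them.\<close>

lemma query_data_word_le:
  assumes "a \<in> set (query_data n cid home par rk)"
    and "\<And>v. v < n \<Longrightarrow> cid v \<le> v"
    and "\<And>j v y. par j v = Some y \<Longrightarrow> y < n"
    and "\<And>j v. v < n \<Longrightarrow> j \<le> home v \<Longrightarrow> rk j v < n"
  shows "a \<le> length (query_data n cid home par rk)"
proof -
  define blk where "blk = block cid home par rk"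
  have len: "length (query_data n cid home par rk) = n + (\<Sum>v<n. length (blk v))"
    by (simp add: length_query_data blk_def length_block sum.distrib sum_distrib_left sum_Suc)
  from assms(1) consider v where "v < n" "a = n + (\<Sum>u<v. length (blk u))" | v where "v < n" "a \<in> set (blk v)"
    by (auto simp: query_data_def blk_def)
  then show ?thesis
  proof cases
    case 1
    then have "(\<Sum>u<v. length (blk u)) \<le> (\<Sum>u<n. length (blk u))" by (intro sum_mono2) auto
    then show ?thesis using 1 len by simp
  next
    case 2
    have "length (blk v) \<le> (\<Sum>v<n. length (blk v))"
      using 2 by (intro member_le_sum) auto
    then have "n \<le> length (query_data n cid home par rk)"
        "2 * home v + 2 \<le> length (query_data n cid home par rk)"
      unfolding len by (auto simp: blk_def length_block)
    moreover have "a < n \<or> a = 2 * home v + 2"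
    proof -
      from 2(2) consider "a = cid v" | "a = 2 * home v + 2"
        | j where "j \<le> home v" "a = (case par j v of None \<Rightarrow> 0 | Some y \<Rightarrow> y)"
        | j where "j \<le> home v" "a = rk j v"
        by (auto simp: blk_def block_def less_Suc_eq_le simp del: upt_Suc)
      then show ?thesis
      proof cases
        case 1
        then show ?thesis using assms(2)[of v] 2(1) by simp
      next
        case (3 j)
        then show ?thesis using assms(3)[of j v] 2(1) by (cases "par j v") auto
      qed (use assms(4) 2(1) in auto)
    qed
    ultimately show ?thesis by linarith
  qed
qed

section \<open>The emulator\<close>

text \<open>
  The lower bound on \<open>L\<close> exceeds the weight of every walk in the trees between two vertices of
  the same component, so these walks avoid the tree edges between different components.
\<close>

locale emulator_construction =
  fixes G :: "nat wgraph" and n k :: nat and b L :: real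
    and home :: "nat \<Rightarrow> nat" and par :: "nat \<Rightarrow> nat \<Rightarrow> nat option" and rk :: "nat \<Rightarrow> nat \<Rightarrow> nat"
  assumes G: "weighted_graph G" "verts G = {..<n}"
    and k: "1 \<le> k"
    and b: "0 \<le> b" "\<And>u v. gdist G u v \<noteq> \<infinity> \<Longrightarrow> gdist G u v \<le> ereal b"
    and L: "b \<le> L" "64 * real k * b < L"
    and hierarchy: "pseudometric.ramsey_hierarchy (trunc_dist L G) k {..<n} home par rk"
begin

abbreviation d where "d \<equiv> trunc_dist L G"

sublocale pseudometric d
proof (rule pseudometric_trunc_dist[OF G(1)])
  show "gdist G u v \<le> ereal L" if "gdist G u v \<noteq> \<infinity>" for u v
    using order_trans[OF b(2)[OF that]] L(1) by simp
qed (use b L in simp)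

text \<open>Tree edges between different components have only the artificial length
  \<open>L\<close>; leaving them out keeps \<open>H\<close> from joining components of
  \<open>G\<close>.\<close>

definition H :: "nat wgraph" where
  "H = \<lparr>verts = {..<n},
        edges = {{x, y} | x y. \<exists>j. par j x = Some y \<and> gdist G x y \<noteq> \<infinity>},
        weight = diam\<rparr>"

lemma par_SomeD:
  assumes "par j x = Some y"
  shows "x < n" "y < n" "j \<le> home x" "j \<le> home y" "rk j y < rk j x" "x \<noteq> y"
proof -
  have "x \<in> {..<n} \<and> y \<in> {..<n} \<and> j \<le> home x \<and> j \<le> home y \<and> rk j y < rk j x"
    using hierarchy assms unfolding ramsey_hierarchy_def by blast
  then show "x < n" "y < n" "j \<le> home x" "j \<le> home y" "rk j y < rk j x" "x \<noteq> y" by auto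
qed

lemma weight_H: "weight H {x, y} = d x y"
  by (simp add: H_def diam_pair)

lemma weighted_graph_H: "weighted_graph H"
  unfolding weighted_graph_def
proof (intro conjI ballI)
  show "finite (verts H)" by (simp add: H_def)
  show "edges H \<subseteq> {{x, y} |x y. x \<in> verts H \<and> y \<in> verts H \<and> x \<noteq> y}"
    by (auto simp: H_def dest: par_SomeD)
  fix e assume "e \<in> edges H"
  then obtain x y where "e = {x, y}" by (auto simp: H_def)
  then show "0 \<le> weight H e" by (simp add: weight_H)
qed

text \<open>Each edge is charged to its child endpoint together with the index of its tree, which is
  at most \<open>home\<close> of that child.\<close>

lemma card_edges_H: "card (edges H) \<le> (\<Sum>x<n. Suc (home x))"
proof -
  have "edges H \<subseteq> (\<lambda>(x, j). {x, the (par j x)}) ` (SIGMA x:{..<n}. {..home x})"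
  proof
    fix e assume "e \<in> edges H"
    then obtain x y j where "e = {x, y}" "par j x = Some y" by (auto simp: H_def)
    then show "e \<in> (\<lambda>(x, j). {x, the (par j x)}) ` (SIGMA x:{..<n}. {..home x})"
      using par_SomeD[of j x y] by (intro image_eqI[of _ _ "(x, j)"]) auto
  qed
  then have "card (edges H) \<le> card (SIGMA x:{..<n}. {..home x})"
    by (rule surj_card_le[rotated]) simp
  also have "\<dots> = (\<Sum>x<n. Suc (home x))" by simp
  finally show ?thesis .
qed

lemma gdist_finite_if_edge:
  assumes "{x, y} \<in> edges H"
  shows "gdist G x y \<noteq> \<infinity>"
proof -
  obtain x' y' where "{x, y} = {x', y'}" "gdist G x' y' \<noteq> \<infinity>"
    using assms by (auto simp: H_def)
  then show ?thesis using gdist_sym[of G x y] by (auto simp: doubleton_eq_iff)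
qed

lemma gdist_finite_if_path:
  assumes "successively (\<lambda>x y. {x, y} \<in> edges H) p" "p \<noteq> []" "last p < n"
  shows "gdist G (hd p) (last p) \<noteq> \<infinity>"
  using assms
proof (induction p rule: induct_list012)
  case (2 x)
  then show ?case using gdist_self[OF G(1)] G(2) by simp
next
  case (3 x y p)
  then have "{x, y} \<in> edges H" by simp
  then have "gdist G x y \<noteq> \<infinity>" by (rule gdist_finite_if_edge)
  moreover have "gdist G y (last (y # p)) \<noteq> \<infinity>" using 3 by simp
  ultimately show ?case using gdist_finite_trans[OF G(1), of x y "last (y # p)"] by simp
qed simp

text \<open>Edges of \<open>H\<close> stay within components of \<open>G\<close>, so the ends of a
  path in \<open>H\<close> are at finite distance. There \<open>d\<close> is the true distance, and
  the triangle inequality applies along the path.\<close>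

lemma gdist_le_gdist_H:
  assumes "v < n"
  shows "gdist G u v \<le> gdist H u v"
proof (cases "gdist H u v = \<infinity>")
  case False
  obtain p where p: "is_path H u p v" "gdist H u v = ereal (path_weight H p)"
    using gdist_attained[OF weighted_graph_H False] by blast
  then have "gdist G u v \<noteq> \<infinity>"
    using gdist_finite_if_path[of p] assms by (auto simp: is_path_def)
  then have "gdist G u v = ereal (d u v)" by (rule gdist_eq_trunc_dist[OF G(1)])
  moreover have "d u v \<le> path_weight H p"
    using dist_le_path_weight[of H p] weight_H p(1) by (auto simp: is_path_def)
  ultimately show ?thesis using p(2) by simp
qed simp

text \<open>The walk in tree \<open>j\<close> weighs at most
  \<open>64 * k * d u v \<le> 64 * k * b < L\<close>, so none of its steps has length
  \<open>L\<close> and all its edges belong to \<open>H\<close>.\<close>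

lemma short_tree_path:
  assumes uv: "u < n" "v < n" and fin: "gdist G u v \<noteq> \<infinity>"
  defines "j \<equiv> min (home u) (home v)"
  obtains p where "tree_path (par j) (rk j) u v p" "is_path H u p v" "length p \<le> n"
    "gdist G u v \<le> ereal (path_weight H p)"
    "ereal (path_weight H p) \<le> ereal (64 * real k) * gdist G u v"
proof -
  have gd: "gdist G u v = ereal (d u v)" by (rule gdist_eq_trunc_dist[OF G(1) fin])
  define S where "S = {x\<in>{..<n}. j \<le> home x}"
  have S: "u \<in> S" "v \<in> S" "inj_on (rk j) S"
    using uv hierarchy by (auto simp: S_def j_def ramsey_hierarchy_def)
  have par: "y \<in> S \<and> rk j y < rk j x" if "par j x = Some y" for x y
    using par_SomeD[OF that] by (auto simp: S_def)
  have "linked (par j) u v (64 * real k * d u v)"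
    using hierarchy uv unfolding ramsey_hierarchy_def j_def by blast
  then obtain z s t where z: "ascent (par j) u z s" "ascent (par j) v z t" "s + t \<le> 64 * real k * d u v"
    unfolding linked_def by blast
  obtain p where p: "tree_path (par j) (rk j) u v p" "path_weight H p \<le> s + t"
    using tree_path_exists[OF z(1,2) S par weight_H] by blast
  have weight: "path_weight H p \<le> 64 * real k * d u v" using p(2) z(3) by simp
  have ends: "p \<noteq> []" "hd p = u" "last p = v" using tree_path_ends[OF p(1)] by auto
  have "set p \<subseteq> S" using tree_path_subset[OF p(1) S(1,2)] par by blast
  then have sub: "set p \<subseteq> {..<n}" by (auto simp: S_def)
  have dist: "distinct p" using tree_path_distinct[OF p(1) S par] by blast
  have "length p = card (set p)" using dist by (simp add: distinct_card)
  then have len: "length p \<le> n" using card_mono[OF _ sub] by simp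
  have "d u v \<le> b" using b(2)[OF fin] gd by simp
  then have "64 * real k * d u v \<le> 64 * real k * b" by (intro mult_left_mono) auto
  then have small: "path_weight H p < L" using weight L(2) by simp
  have "successively (\<lambda>x y. {x, y} \<in> edges H) p"
    unfolding successively_conv_nth
  proof (intro allI impI)
    fix i assume i: "Suc i < length p"
    define x y where "x = p ! i" and "y = p ! Suc i"
    have "d x y \<le> path_weight H p"
      using successively_nth[OF step_le_path_weight[OF weight_H] i] by (simp add: x_def y_def)
    moreover have link: "par j x = Some y \<or> par j y = Some x"
      using successively_nth[OF tree_path_successively[OF p(1)] i] by (simp add: x_def y_def)
    moreover have "x \<noteq> y" using link par_SomeD(6) by blast
    ultimately have "gdist G x y \<noteq> \<infinity>" using small by (auto simp: trunc_dist_def)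
    moreover from this have "gdist G y x \<noteq> \<infinity>" using gdist_sym[of G x y] by simp
    ultimately have "{x, y} \<in> edges H" using link by (auto simp: H_def insert_commute)
    then show "{p ! i, p ! Suc i} \<in> edges H" by (simp add: x_def y_def)
  qed
  then have path: "is_path H u p v" using ends sub dist by (simp add: is_path_def H_def)
  have "d u v \<le> path_weight H p" using dist_le_path_weight[OF weight_H ends(1)] ends by simp
  then show thesis using that p(1) path len weight gd by simp
qed

lemma emulator_H: "emulator (64 * real k) G H"
  unfolding emulator_def
proof (intro conjI ballI)
  fix u v assume uv: "u \<in> verts G" "v \<in> verts G"
  then show "gdist G u v \<le> gdist H u v" using gdist_le_gdist_H G(2) by simp
  show "gdist H u v \<le> ereal (64 * real k) * gdist G u v"
  proof (cases "gdist G u v = \<infinity>")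
    case True
    then show ?thesis using k by simp
  next
    case False
    obtain p where p: "is_path H u p v"
      "ereal (path_weight H p) \<le> ereal (64 * real k) * gdist G u v"
      using short_tree_path[of u v] uv G(2) False by (metis lessThan_iff)
    show ?thesis using gdist_le[OF p(1)] p(2) by (rule order_trans)
  qed
qed (use weighted_graph_H G(2) in \<open>auto simp: H_def\<close>)

abbreviation D where "D \<equiv> query_data n (component G) home par rk"

text \<open>One run witnesses both correctness and speed. The empty answer has path length 0, so the
  additive constant pays for its six steps.\<close>

lemma query_correct:
  assumes w: "2 \<le> w" "length D < 2 ^ w" and uv: "u < n" "v < n"
  shows "\<exists>t p. answers_within w query_prog D u v t p \<and> correct_answer (64 * real k) G H u v p \<and>
           real t \<le> 21 * (1 + real (path_length p))"
proof -
  have E: "encodes w D n (component G) home par rk" using encodes_query_data[OF w] .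
  have comp: "component G u = component G v \<longleftrightarrow> gdist G u v \<noteq> \<infinity>"
    using component_eq_iff[OF G(1)] uv G(2) by simp
  show ?thesis
  proof (cases "gdist G u v = \<infinity>")
    case True
    then have "answers_within w query_prog D u v 6 []"
      using run_header_disconnected[OF E uv] comp by simp
    moreover have "correct_answer (64 * real k) G H u v []" using True by (simp add: correct_answer_def)
    ultimately show ?thesis by (intro exI[of _ 6] exI[of _ "[]"]) (auto simp: path_length_def)
  next
    case False
    define j where "j = min (home u) (home v)"
    obtain p where p: "tree_path (par j) (rk j) u v p" "is_path H u p v" "length p \<le> n"
      "gdist G u v \<le> ereal (path_weight H p)"
      "ereal (path_weight H p) \<le> ereal (64 * real k) * gdist G u v"
      using short_tree_path[OF uv False] unfolding j_def by blast
    have "\<forall>x y. par j x = Some y \<longrightarrow> y < n \<and> j \<le> home y" using par_SomeD by blast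
    then obtain t where "answers_within w query_prog D u v t p" "real t \<le> 21 * (1 + real (path_length p))"
      using answers_within_tree_path[OF E uv _ _ _ p(3)] p(1) comp False unfolding j_def by blast
    moreover have "correct_answer (64 * real k) G H u v p"
      using p False by (simp add: correct_answer_def)
    ultimately show ?thesis by blast
  qed
qed

text \<open>For \<open>n = 0\<close> the word size chosen later is 0, so the lower bound on
  \<open>w\<close> is asked only for nonempty graphs; otherwise there are no queries.\<close>

lemma interactive_emulator_H:
  assumes w: "0 < n \<Longrightarrow> 2 \<le> w" "length D < 2 ^ w"
  shows "interactive_emulator w query_prog (64 * real k) G H D"
    and "query_time w query_prog G D 21 1"
proof -
  have "a < 2 ^ w" if "a \<in> set D" for a
  proof -
    have "a \<le> length D"
    proof (rule query_data_word_le[OF that])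
      show "component G v \<le> v" if "v < n" for v using component_le[OF G(1)] that G(2) by simp
      show "rk j v < n" if "v < n" "j \<le> home v" for j v
        using hierarchy that by (simp add: ramsey_hierarchy_def)
    qed (rule par_SomeD(2))
    then show ?thesis using w(2) by simp
  qed
  moreover have query: "\<exists>t p. answers_within w query_prog D u v t p \<and>
      correct_answer (64 * real k) G H u v p \<and> real t \<le> 21 * (1 + real (path_length p))"
    if "u \<in> verts G" "v \<in> verts G" for u v
    using query_correct[OF w(1) w(2)] that G(2) by simp
  ultimately show "interactive_emulator w query_prog (64 * real k) G H D"
    unfolding interactive_emulator_def using emulator_H by blast
  show "query_time w query_prog G D 21 1"
    unfolding query_time_def using query by blast
qed

end

section \<open>Choice of parameters and size bounds\<close>

lemma emulator_construction_exists:
  assumes "weighted_graph G" "verts G = {..<n}" "1 \<le> k"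
  obtains b L home par rk where "emulator_construction G n k b L home par rk"
    "real (\<Sum>x<n. Suc (home x)) \<le> real n * real n powr (1 / real k)"
proof -
  obtain b where b: "0 \<le> b" "\<And>u v. gdist G u v \<noteq> \<infinity> \<Longrightarrow> gdist G u v \<le> ereal b"
    using gdist_bounded[OF assms(1)] by blast
  \<comment> \<open>The sum dominates both lower bounds for \<open>L\<close>, and the 1 makes the
    second one strict.\<close>
  define L where "L = 64 * real k * b + b + 1"
  have kb: "0 \<le> 64 * real k * b" using b(1) by simp
  have L: "b \<le> L" "64 * real k * b < L" using b(1) kb by (auto simp: L_def)
  interpret pseudometric "trunc_dist L G"
  proof (rule pseudometric_trunc_dist[OF assms(1)])
    show "gdist G u v \<le> ereal L" if "gdist G u v \<noteq> \<infinity>" for u v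
      using order_trans[OF b(2)[OF that]] L(1) by simp
  qed (use b L in simp)
  obtain home par rk where h: "ramsey_hierarchy k {..<n} home par rk"
    "real (\<Sum>x<n. Suc (home x)) \<le> real n * real n powr (1 / real k)"
    using ramsey_hierarchy_exists[of "{..<n}" k "real n"] assms(3) by auto
  have "emulator_construction G n k b L home par rk"
    using assms b L h(1) by unfold_locales auto
  then show thesis using that h(2) by blast
qed

text \<open>As \<open>n + 1 \<le> 2 ^ floorlog 2 n\<close> for positive \<open>n\<close>, it
  suffices that the expansion of \<open>(n + 1) ^ 4\<close> dominates the left side.\<close>

lemma query_data_length_less_word:
  assumes "s \<le> n * n"
  shows "3 * n + 2 * s < 2 ^ (4 * floorlog 2 n)"
proof (cases "n = 0")
  case False
  then have "n < 2 ^ floorlog 2 n" using floorlog_bounds[of n 2] by simp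
  then have "(n + 1) ^ 4 \<le> (2 ^ floorlog 2 n) ^ 4" by (intro power_mono) auto
  also have "\<dots> = 2 ^ (4 * floorlog 2 n)" by (simp add: power_mult[symmetric] mult.commute)
  finally have "(n + 1) ^ 4 \<le> 2 ^ (4 * floorlog 2 n)" .
  moreover have "(n + 1) ^ 4 = n ^ 4 + 4 * n ^ 3 + 6 * (n * n) + 4 * n + 1"
    by (simp add: power4_eq_xxxx power3_eq_cube algebra_simps)
  ultimately show ?thesis using assms by linarith
qed (use assms in simp)

theorem theorem4:
  shows "\<exists>(prog :: instr list) (c :: nat) (A :: real) (S :: real) (B :: real) (q :: real).
    \<forall>(n :: nat) (k :: nat) (G :: nat wgraph).
      weighted_graph G \<and> verts G = {..<n} \<and> 1 \<le> k \<longrightarrow>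
      (\<exists>(H :: nat wgraph) (D :: nat list).
         interactive_emulator (c * floorlog 2 n) prog (A * real k) G H D \<and>
         real (emulator_size H D) \<le> S * real n powr (1 + 1 / real k) \<and>
         query_time (c * floorlog 2 n) prog G D B q)"
proof (rule exI[of _ query_prog], rule exI[of _ 4], rule exI[of _ 64], rule exI[of _ 5],
    rule exI[of _ 21], rule exI[of _ 1], intro allI impI)
  fix n k :: nat and G :: "nat wgraph"
  assume *: "weighted_graph G \<and> verts G = {..<n} \<and> 1 \<le> k"
  then obtain b L home par rk where "emulator_construction G n k b L home par rk"
    and sum: "real (\<Sum>x<n. Suc (home x)) \<le> real n * real n powr (1 / real k)"
    using emulator_construction_exists by blast
  then interpret emulator_construction G n k b L home par rk by blast
  define s where "s = (\<Sum>x<n. Suc (home x))"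
  define w where "w = 4 * floorlog 2 n"
  have len: "length D = 3 * n + 2 * s" by (simp add: length_query_data s_def)
  have powr_le: "real n powr (1 / real k) \<le> real n" if "0 < n"
  proof -
    have "real n powr (1 / real k) \<le> real n powr 1" using that k by (intro powr_mono) auto
    then show ?thesis by simp
  qed
  \<comment> \<open>A crude bound, independent of \<open>k\<close>, that serves to fix the word
    size.\<close>
  have "real s \<le> real n * real n"
  proof (cases "n = 0")
    case False
    then show ?thesis using sum powr_le unfolding s_def by (meson mult_left_mono neq0_conv of_nat_0_le_iff order_trans)
  qed (simp add: s_def)
  then have "s \<le> n * n" by (metis of_nat_le_iff of_nat_mult)
  then have "length D < 2 ^ w" unfolding len w_def by (rule query_data_length_less_word)
  moreover have "2 \<le> w" if "0 < n" using that floorlog_eq_zero_iff[of 2 n] by (simp add: w_def)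
  ultimately have "interactive_emulator w query_prog (64 * real k) G H D" "query_time w query_prog G D 21 1"
    using interactive_emulator_H by auto
  moreover have "real (emulator_size H D) \<le> 5 * real n powr (1 + 1 / real k)"
  proof (cases "n = 0")
    \<comment> \<open>Since \<open>0 powr y\<close> is 0, both the edge set and the data must be
      empty here.\<close>
    case True
    then show ?thesis using card_edges_H len by (simp add: emulator_size_def s_def)
  next
    case False
    define x where "x = real n powr (1 + 1 / real k)"
    \<comment> \<open>The constant 5 is 3 + 2: both \<open>n\<close> and \<open>s\<close> are at
      most \<open>x\<close>, and the data have length \<open>3 * n + 2 * s\<close>.\<close>
    have "real s \<le> x" using sum False by (simp add: s_def x_def powr_add)
    moreover have "real n \<le> x"
    proof -
      have "real n powr 1 \<le> x" unfolding x_def using False by (intro powr_mono) auto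
      then show ?thesis by simp
    qed
    moreover have "card (edges H) \<le> s" using card_edges_H by (simp add: s_def)
    ultimately show ?thesis unfolding emulator_size_def len x_def[symmetric] by (simp add: max_def)
  qed
  ultimately show "\<exists>(H :: nat wgraph) D. interactive_emulator (4 * floorlog 2 n) query_prog (64 * real k) G H D \<and>
      real (emulator_size H D) \<le> 5 * real n powr (1 + 1 / real k) \<and>
      query_time (4 * floorlog 2 n) query_prog G D 21 1"
    unfolding w_def by blast
qed

end
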